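(* Let $n\ge 2$ be an odd integer that is not a prime power. Then for every compact Hausdorff space $X$ with a free continuous action of the symmetric group $\mathfrak S_n$ there exists a continuous $\mathfrak S_n$-equivariant map $X\to\mathbb R^n$ whose image does not intersect the diagonal $D_n=\{(u,u,\dots,u)\in\mathbb R^n : u\in\mathbb R\}$.
   Context: $\mathfrak S_n$ is the group of all permutations of $\{1,\dots,n\}$; it acts on $\mathbb R^n$ by permuting the coordinates. *)

theory Defs
  imports
    "HOL-Analysis.Analysis"
    "HOL-Algebra.Sym_Groups"
    "HOL-Algebra.Group_Action"
    "HOL-Number_Theory.Prime_Powers"
begin

text \<open>The acting group carries the discrete topology, so continuity is joint continuity of
  \<open>G \<times> X \<rightarrow> X\<close>.\<close>

definition continuous_group_action ::
    "('g, 'm) monoid_scheme \<Rightarrow> 'a topology \<Rightarrow> ('g \<Rightarrow> 'a \<Rightarrow> 'a) \<Rightarrow> bool" where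
  "continuous_group_action G X \<phi> \<longleftrightarrow>
     group_action G (topspace X) \<phi> \<and>
     continuous_map (prod_topology (discrete_topology (carrier G)) X) X (\<lambda>(g, x). \<phi> g x)"

definition free_group_action ::
    "('g, 'm) monoid_scheme \<Rightarrow> 'a set \<Rightarrow> ('g \<Rightarrow> 'a \<Rightarrow> 'a) \<Rightarrow> bool" where
  "free_group_action G E \<phi> \<longleftrightarrow>
     group_action G E \<phi> \<and> (\<forall>x\<in>E. stabilizer G \<phi> x = {\<one>\<^bsub>G\<^esub>})"

definition equivariant_map ::
    "('g, 'm) monoid_scheme \<Rightarrow> 'a set \<Rightarrow> ('g \<Rightarrow> 'a \<Rightarrow> 'a) \<Rightarrow> ('g \<Rightarrow> 'b \<Rightarrow> 'b) \<Rightarrow> ('a \<Rightarrow> 'b) \<Rightarrow> bool" where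
  "equivariant_map G E \<phi> \<psi> f \<longleftrightarrow> (\<forall>g\<in>carrier G. \<forall>x\<in>E. f (\<phi> g x) = \<psi> g (f x))"

text \<open>\<open>\<real>\<^sup>n\<close> is the space of functions on \<open>{1..n}\<close>, extensional in the sense that they take the value
  \<open>undefined\<close> elsewhere, with the product topology.\<close>

abbreviation real_space :: "nat \<Rightarrow> (nat \<Rightarrow> real) topology" where
  "real_space n \<equiv> powertop_real {1..n}"

text \<open>The inverse makes this a left action: it moves the \<open>i\<close>-th coordinate to position \<open>\<sigma> i\<close>.\<close>

definition coord_perm :: "nat \<Rightarrow> (nat \<Rightarrow> nat) \<Rightarrow> (nat \<Rightarrow> real) \<Rightarrow> (nat \<Rightarrow> real)" where
  "coord_perm n \<sigma> = (\<lambda>v\<in>topspace (real_space n). \<lambda>i\<in>{1..n}. v (inv' \<sigma> i))"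

definition diagonal :: "nat \<Rightarrow> (nat \<Rightarrow> real) set" where
  "diagonal n = {(\<lambda>i\<in>{1..n}. u) | u. True}"

lemma coord_perm_group_action:
  "group_action (sym_group n) (topspace (real_space n)) (coord_perm n)"
proof -
  let ?E = "topspace (real_space n)"
  have cl: "coord_perm n \<sigma> v \<in> ?E" if "v \<in> ?E" for \<sigma> v
    using that by (auto simp: coord_perm_def)
  have comp: "coord_perm n (\<sigma> \<circ> \<tau>) v = coord_perm n \<sigma> (coord_perm n \<tau> v)"
    if "\<sigma> permutes {1..n}" "\<tau> permutes {1..n}" "v \<in> ?E" for \<sigma> \<tau> v
  proof -
    have "inv' (\<sigma> \<circ> \<tau>) = inv' \<tau> \<circ> inv' \<sigma>"
      using that by (simp add: o_inv_distrib permutes_bij)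
    moreover have "inv' \<sigma> i \<in> {1..n}" if "i \<in> {1..n}" for i
      using permutes_in_image[OF permutes_inv[OF \<open>\<sigma> permutes {1..n}\<close>]] that by blast
    ultimately show ?thesis
      using that(3) cl[OF that(3), of \<tau>] by (auto simp: coord_perm_def fun_eq_iff)
  qed
  have one: "coord_perm n id v = v" if "v \<in> ?E" for v
    using that by (auto simp: coord_perm_def fun_eq_iff PiE_def extensional_def)
  have bij: "coord_perm n \<sigma> \<in> Bij ?E" if s: "\<sigma> permutes {1..n}" for \<sigma>
  proof -
    have "bij_betw (coord_perm n \<sigma>) ?E ?E"
    proof (rule bij_betw_byWitness[where f' = "coord_perm n (inv' \<sigma>)"])
      show "\<forall>v\<in>?E. coord_perm n (inv' \<sigma>) (coord_perm n \<sigma> v) = v"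
        using comp[OF permutes_inv[OF s] s] permutes_inv_o(2)[OF s] one by metis
      show "\<forall>v\<in>?E. coord_perm n \<sigma> (coord_perm n (inv' \<sigma>) v) = v"
        using comp[OF s permutes_inv[OF s]] permutes_inv_o(1)[OF s] one by metis
    qed (use cl in blast)+
    then show ?thesis
      unfolding Bij_def coord_perm_def by auto
  qed
  have "coord_perm n \<in> hom (sym_group n) (BijGroup ?E)"
  proof (rule homI)
    fix \<sigma> assume "\<sigma> \<in> carrier (sym_group n)"
    then show "coord_perm n \<sigma> \<in> carrier (BijGroup ?E)"
      using bij by (simp add: sym_group_carrier BijGroup_def)
  next
    fix \<sigma> \<tau> assume "\<sigma> \<in> carrier (sym_group n)" "\<tau> \<in> carrier (sym_group n)"
    then have s: "\<sigma> permutes {1..n}" "\<tau> permutes {1..n}"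
      by (simp_all add: sym_group_carrier)
    have "coord_perm n (\<sigma> \<circ> \<tau>) = compose ?E (coord_perm n \<sigma>) (coord_perm n \<tau>)"
    proof
      fix v
      show "coord_perm n (\<sigma> \<circ> \<tau>) v = compose ?E (coord_perm n \<sigma>) (coord_perm n \<tau>) v"
      proof (cases "v \<in> ?E")
        case True
        then show ?thesis using comp[OF s] by (simp add: compose_def)
      next
        case False
        then show ?thesis by (simp add: compose_def coord_perm_def)
      qed
    qed
    then show "coord_perm n (\<sigma> \<otimes>\<^bsub>sym_group n\<^esub> \<tau>) =
        coord_perm n \<sigma> \<otimes>\<^bsub>BijGroup ?E\<^esub> coord_perm n \<tau>"
      using bij s by (simp add: sym_group_mult BijGroup_def)
  qed
  then show ?thesis
    by (simp add: group_action_def group_hom_def group_hom_axioms_def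
        sym_group_is_group group_BijGroup)
qed

end

theory Submission
  imports Defs "HOL-Algebra.Exponent"
begin

text \<open>
  Let \<open>S\<close> be the unit sphere in the hyperplane of vectors with coordinate sum 0; it has odd dimension
  \<open>n - 2\<close>. If \<open>S\<close> has an equivariant self-map \<open>\<Psi>\<close> that is null-homotopic, then \<open>\<Psi>\<close> extends to a map
  \<open>\<Phi>\<close> of the whole space into the nonconstant vectors. An equivariant map \<open>f : Z \<rightarrow> S\<close> on a closed
  invariant set can then be replaced by \<open>\<Psi> \<circ> f\<close> and extended over the translates of a closed set \<open>K\<close>
  with pairwise disjoint translates: extend the coordinates of \<open>f\<close> over \<open>K\<close> by Tietze, apply \<open>\<Phi>\<close>,
  and translate. Finitely many such \<open>K\<close> have translates covering \<open>X\<close>.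

  To get \<open>\<Psi>\<close>, start with the identity and, near the point of \<open>S\<close> corresponding to a proper nonempty
  subset \<open>A\<close> of \<open>{1..n}\<close>, rotate \<open>x\<close> in the plane spanned by \<open>x\<close> and this point, by
  \<open>j\<^sub>A\<close> half turns at the point itself. Each half turn changes the degree by \<open>\<plusminus> 1\<close> with a sign independent of \<open>A\<close>,
  since \<open>n\<close> is odd. As \<open>n\<close> is not a prime power, the numbers \<open>n choose k\<close>, \<open>0 < k < n\<close>,
  have gcd 1, so \<open>j\<^sub>A\<close> can be chosen to depend only on \<open>card A\<close> and to have sum 1, which makes the degree 0.

  Instead of invoking the Hopf theorem, the bumps are moved (not equivariantly) into a plane. Then the
  coordinates complementary to the plane are only multiplied by a real function; they are even in number, so
  this factor can be deformed to 1 through complex numbers. What remains is the winding number of a map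
  of a closed curve into the punctured plane, and it is \<open>1 - (\<Sum>A. j\<^sub>A) = 0\<close>.
\<close>

section \<open>Binomial coefficients and digit expansions\<close>

lemma bezout_sum:
  fixes f :: "'b \<Rightarrow> int"
  assumes "finite A"
  shows "\<exists>c. (\<Sum>a\<in>A. c a * f a) = Gcd (f ` A)"
  using assms
proof (induction A rule: finite_induct)
  case (insert a A)
  then obtain c where c: "(\<Sum>a\<in>A. c a * f a) = Gcd (f ` A)"
    by blast
  obtain u v where uv: "u * f a + v * Gcd (f ` A) = gcd (f a) (Gcd (f ` A))"
    using bezout_int by blast
  have "(\<Sum>b\<in>insert a A. (if b = a then u else v * c b) * f b)
      = u * f a + (\<Sum>b\<in>A. (if b = a then u else v * c b) * f b)"
    using insert by simp
  also have "(\<Sum>b\<in>A. (if b = a then u else v * c b) * f b) = v * (\<Sum>b\<in>A. c b * f b)"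
    unfolding sum_distrib_left using insert(2) by (intro sum.cong) auto
  also have "u * f a + v * (\<Sum>b\<in>A. c b * f b) = Gcd (f ` insert a A)"
    using c uv by simp
  finally show ?case
    by (rule exI[where x = "\<lambda>b. if b = a then u else v * c b"])
qed simp

text \<open>If \<open>p\<close> does not divide \<open>n\<close>, take \<open>k = 1\<close>.
  Otherwise take the full power of \<open>p\<close> in \<open>n\<close>: with
  \<open>n = p ^ e * m\<close>, the coefficient at \<open>p ^ e\<close> has the same multiplicity of
  \<open>p\<close> as \<open>m\<close>, namely 0, and \<open>m > 1\<close> because \<open>n\<close>
  is not a prime power.\<close>

lemma ex_prime_not_dvd_binomial:
  assumes "n \<ge> 2" "\<not> primepow n" "prime p"
  shows "\<exists>k\<in>{1..<n}. \<not> p dvd (n choose k)"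
proof (cases "p dvd n")
  case False
  then show ?thesis
    using assms(1) by (intro bexI[of _ 1]) auto
next
  case True
  define e where "e = multiplicity p n"
  obtain m where n: "n = p ^ e * m" and m: "\<not> p dvd m"
    using multiplicity_decompose'[of n p] assms unfolding e_def
    by (metis not_prime_unit not_numeral_le_zero)
  have "e > 0"
    unfolding e_def using True assms by (simp add: prime_multiplicity_gt_zero_iff)
  then have "m \<noteq> 1"
    using n assms(2,3) by (metis mult.right_neutral primepow_def)
  moreover have "m \<noteq> 0"
    using n assms(1) by (intro notI) simp
  ultimately have "m > 1"
    by linarith
  then have "p ^ e * 1 < p ^ e * m"
    using assms(3) by (intro mult_strict_left_mono) (auto simp: prime_gt_0_nat)
  then have "p ^ e < n"
    using n by simp
  moreover have "\<not> p dvd (n choose p ^ e)"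
  proof -
    have "multiplicity p (n choose p ^ e) = multiplicity p m"
      using const_p_fac[of m p e] assms(3) \<open>m > 1\<close> by (subst n) auto
    then show ?thesis
      using m \<open>p ^ e < n\<close> assms(3) by (metis binomial_eq_0_iff not_dvd_imp_multiplicity_0 not_less_iff_gr_or_eq prime_multiplicity_gt_zero_iff prime_elem_nat_iff prime_imp_prime_elem less_irrefl)
  qed
  ultimately show ?thesis
    using assms(3) by (intro bexI[of _ "p ^ e"]) (auto simp: Suc_le_eq prime_gt_0_nat)
qed

text \<open>A prime divisor of the gcd would divide all these binomial coefficients, so the gcd is 1
  and Bezout supplies \<open>c\<close>.\<close>

lemma ex_binomial_combination_1:
  assumes "n \<ge> 2" "\<not> primepow n"
  shows "\<exists>c::nat \<Rightarrow> int. (\<Sum>k\<in>{1..<n}. c k * int (n choose k)) = 1"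
proof -
  let ?D = "Gcd ((\<lambda>k. int (n choose k)) ` {1..<n})"
  have "?D = 1"
  proof (rule ccontr)
    assume "?D \<noteq> 1"
    moreover have "?D \<noteq> 0"
      using assms(1) by (auto simp: Gcd_0_iff image_subset_iff intro!: bexI[of _ 1])
    ultimately obtain q where "prime q" "q dvd ?D"
      using prime_divisor_exists[of ?D] by (metis is_unit_normalize normalize_Gcd)
    then obtain p where p: "prime p" "int p dvd ?D"
      by (metis prime_int_nat_transfer prime_ge_0_int nat_0_le)
    obtain k where "k \<in> {1..<n}" "\<not> p dvd (n choose k)"
      using ex_prime_not_dvd_binomial[OF assms p(1)] by blast
    moreover have "int p dvd int (n choose k)" if "k \<in> {1..<n}" for k
      using p(2) that by (meson Gcd_dvd dvd_trans imageI)
    ultimately show False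
      by simp
  qed
  then show ?thesis
    using bezout_sum[of "{1..<n}" "\<lambda>k. int (n choose k)"] by simp
qed

definition proper_subsets :: "nat \<Rightarrow> nat set set" where
  "proper_subsets n = {A. A \<subseteq> {1..n} \<and> A \<noteq> {} \<and> A \<noteq> {1..n}}"

lemma finite_proper_subsets [simp]: "finite (proper_subsets n)"
  by (rule finite_subset[of _ "Pow {1..n}"]) (auto simp: proper_subsets_def)

text \<open>Turns an integer combination of binomial coefficients into the total weight of bumps
  whose weights depend only on the size of the subset, as symmetry demands.\<close>

lemma sum_proper_subsets_card:
  fixes c :: "nat \<Rightarrow> int"
  shows "(\<Sum>A\<in>proper_subsets n. c (card A)) = (\<Sum>k\<in>{1..<n}. c k * int (n choose k))"
proof -
  have card: "card A \<in> {1..<n}" if "A \<in> proper_subsets n" for A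
  proof -
    have "finite A" "A \<noteq> {}" "A \<subset> {1..n}"
      using that by (auto simp: proper_subsets_def intro: finite_subset)
    then show ?thesis
      using psubset_card_mono[of "{1..n}" A] by (auto simp: Suc_le_eq card_gt_0_iff)
  qed
  have eq: "{A \<in> proper_subsets n. card A = k} = {A. A \<subseteq> {1..n} \<and> card A = k}" if "k \<in> {1..<n}" for k
    using that by (auto simp: proper_subsets_def)
  have "(\<Sum>A\<in>proper_subsets n. c (card A))
      = (\<Sum>k\<in>{1..<n}. \<Sum>A | A \<in> proper_subsets n \<and> card A = k. c (card A))"
    by (rule sum.group[symmetric]) (use card in auto)
  also have "\<dots> = (\<Sum>k\<in>{1..<n}. \<Sum>A | A \<subseteq> {1..n} \<and> card A = k. c k)"
    by (intro sum.cong) (use eq in auto)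
  also have "\<dots> = (\<Sum>k\<in>{1..<n}. c k * int (n choose k))"
    by (intro sum.cong) (simp_all add: n_subsets mult.commute)
  finally show ?thesis .
qed

text \<open>Modulo \<open>K\<close> the sum is its lowest digit, which is thus a multiple of
  \<open>K\<close> and smaller than \<open>K\<close> in absolute value. After division by
  \<open>K\<close> the other digits follow by induction.\<close>

lemma digits_eq_0:
  fixes d :: "nat \<Rightarrow> int"
  assumes "(\<Sum>i<m. d i * K ^ i) = 0" and "\<And>i. i < m \<Longrightarrow> \<bar>d i\<bar> < K" and "i < m"
  shows "d i = 0"
  using assms
proof (induction m arbitrary: d i)
  case (Suc m)
  have split: "(\<Sum>i<Suc m. d i * K ^ i) = d 0 + K * (\<Sum>i<m. d (Suc i) * K ^ i)"
    unfolding sum.lessThan_Suc_shift by (simp add: sum_distrib_left mult_ac)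
  then have "K dvd d 0"
    using Suc.prems(1) by (metis add.commute add_eq_0_iff dvd_minus_iff dvd_triv_left)
  then have d0: "d 0 = 0"
    using Suc.prems(2)[of 0] by (metis abs_of_nonneg dvd_imp_le_int linorder_not_le zero_less_Suc abs_le_iff abs_ge_self order_trans)
  have "K \<noteq> 0"
    using Suc.prems(2)[of 0] by auto
  then have "(\<Sum>i<m. d (Suc i) * K ^ i) = 0"
    using split d0 Suc.prems(1) by simp
  then have "d (Suc j) = 0" if "j < m" for j
    using Suc.IH[of "\<lambda>i. d (Suc i)" j] Suc.prems(2) that by auto
  then show ?case
    using d0 Suc.prems(3) by (cases i) auto
qed simp

section \<open>Equivariant extension over translates of a closed set\<close>

definition nonconst :: "nat \<Rightarrow> (nat \<Rightarrow> real) set" where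
  "nonconst n = {x. \<exists>i\<in>{1..n}. \<exists>k\<in>{1..n}. x i \<noteq> x k}"

definition mean :: "nat \<Rightarrow> (nat \<Rightarrow> real) \<Rightarrow> real" where
  "mean n x = (\<Sum>i=1..n. x i) / n"

definition inner_n :: "nat \<Rightarrow> (nat \<Rightarrow> real) \<Rightarrow> (nat \<Rightarrow> real) \<Rightarrow> real" where
  "inner_n n x y = (\<Sum>i=1..n. x i * y i)"

text \<open>Vectors are total functions, so that the type-class product topology applies. The value
  0 outside \<open>{1..n}\<close> makes vectors of the hyperplane equal once their \<open>n\<close>
  coordinates agree.\<close>

definition hyperplane :: "nat \<Rightarrow> (nat \<Rightarrow> real) set" where
  "hyperplane n = {x. (\<forall>i. i \<notin> {1..n} \<longrightarrow> x i = 0) \<and> (\<Sum>i=1..n. x i) = 0}"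

definition unit_sphere :: "nat \<Rightarrow> (nat \<Rightarrow> real) set" where
  "unit_sphere n = {x \<in> hyperplane n. inner_n n x x = 1}"

definition center :: "nat \<Rightarrow> (nat \<Rightarrow> real) \<Rightarrow> (nat \<Rightarrow> real)" where
  "center n x = (\<lambda>i. if i \<in> {1..n} then x i - mean n x else 0)"

definition normalize_vec :: "nat \<Rightarrow> (nat \<Rightarrow> real) \<Rightarrow> (nat \<Rightarrow> real)" where
  "normalize_vec n x = (\<lambda>i. x i / sqrt (inner_n n x x))"

lemma continuous_on_inner_n [continuous_intros]:
  fixes f g :: "'a::topological_space \<Rightarrow> nat \<Rightarrow> real"
  assumes "continuous_on S f" "continuous_on S g"
  shows "continuous_on S (\<lambda>x. inner_n n (f x) (g x))"
  unfolding inner_n_def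
  by (intro continuous_intros continuous_on_product_then_coordinatewise[OF assms(1)]
      continuous_on_product_then_coordinatewise[OF assms(2)])

lemma continuous_on_center [continuous_intros]:
  fixes f :: "'a::topological_space \<Rightarrow> nat \<Rightarrow> real"
  assumes "continuous_on S f"
  shows "continuous_on S (\<lambda>x. center n (f x))"
proof (rule continuous_on_coordinatewise_then_product)
  show "continuous_on S (\<lambda>x. center n (f x) i)" for i
    unfolding center_def mean_def divide_inverse
    by (cases "i \<in> {1..n}")
      (auto intro!: continuous_intros continuous_on_product_then_coordinatewise[OF assms])
qed

lemma inner_n_self_nonneg: "inner_n n x x \<ge> 0"
  by (auto simp: inner_n_def intro!: sum_nonneg)

lemma inner_n_self_eq_0: "inner_n n x x = 0 \<longleftrightarrow> (\<forall>i\<in>{1..n}. x i = 0)"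
  unfolding inner_n_def by (subst sum_nonneg_eq_0_iff) auto

lemma inner_n_commute: "inner_n n x y = inner_n n y x"
  by (simp add: inner_n_def mult.commute)

lemma inner_n_add_right: "inner_n n x (\<lambda>i. y i + z i) = inner_n n x y + inner_n n x z"
  by (simp add: inner_n_def algebra_simps sum.distrib)

lemma inner_n_scale_right: "inner_n n x (\<lambda>i. c * y i) = c * inner_n n x y"
  by (simp add: inner_n_def algebra_simps sum_distrib_left)

lemma inner_n_permute:
  assumes "p permutes {1..n}"
  shows "inner_n n (x \<circ> p) (y \<circ> p) = inner_n n x y"
  unfolding inner_n_def comp_def by (rule sum.permute[OF assms, symmetric, unfolded comp_def])

lemma mean_permute:
  assumes "p permutes {1..n}"
  shows "mean n (x \<circ> p) = mean n x"
  unfolding mean_def using sum.permute[OF assms, of x] by (simp add: comp_def)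

lemma center_permute:
  assumes "p permutes {1..n}"
  shows "center n (x \<circ> p) = center n x \<circ> p"
  using permutes_in_image[OF assms] mean_permute[OF assms] by (auto simp: center_def fun_eq_iff)

lemma normalize_vec_permute:
  assumes "p permutes {1..n}"
  shows "normalize_vec n (x \<circ> p) = normalize_vec n x \<circ> p"
  by (simp add: normalize_vec_def fun_eq_iff inner_n_permute[OF assms])

lemma center_in_hyperplane:
  assumes "n > 0"
  shows "center n x \<in> hyperplane n"
  using assms by (simp add: hyperplane_def center_def mean_def sum_subtractf)

lemma hyperplane_const_imp_0:
  assumes "x \<in> hyperplane n" "x \<notin> nonconst n"
  shows "x i = 0"
proof (cases "i \<in> {1..n}")
  case True
  then have "(\<Sum>k=1..n. x k) = (\<Sum>k=1..n. x i)"
    using assms(2) unfolding nonconst_def by (intro sum.cong) blast+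
  then show ?thesis
    using True assms(1) by (simp add: hyperplane_def)
qed (use assms in \<open>auto simp: hyperplane_def\<close>)

lemma normalize_vec_in_unit_sphere:
  assumes "x \<in> hyperplane n" "inner_n n x x \<noteq> 0"
  shows "normalize_vec n x \<in> unit_sphere n"
proof -
  have "inner_n n (normalize_vec n x) (normalize_vec n x) = inner_n n x x / (sqrt (inner_n n x x))\<^sup>2"
    by (simp add: inner_n_def normalize_vec_def sum_divide_distrib power2_eq_square)
  also have "\<dots> = 1"
    using assms(2) inner_n_self_nonneg[of n x] by simp
  finally show ?thesis
    using assms(1) by (auto simp: unit_sphere_def hyperplane_def normalize_vec_def
        simp flip: sum_divide_distrib)
qed

lemma unit_sphere_subset_nonconst: "unit_sphere n \<subseteq> nonconst n"
proof
  fix x assume x: "x \<in> unit_sphere n"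
  show "x \<in> nonconst n"
  proof (rule ccontr)
    assume "x \<notin> nonconst n"
    then have "x i = 0" for i
      using x hyperplane_const_imp_0 by (auto simp: unit_sphere_def)
    then show False
      using x by (simp add: unit_sphere_def inner_n_def)
  qed
qed

lemma inner_n_center_nonzero:
  assumes "x \<in> nonconst n"
  shows "inner_n n (center n x) (center n x) \<noteq> 0"
proof
  assume "inner_n n (center n x) (center n x) = 0"
  then have "x i = mean n x" if "i \<in> {1..n}" for i
    using that by (auto simp: inner_n_self_eq_0 center_def)
  then show False
    using assms by (auto simp: nonconst_def)
qed

text \<open>Orthogonal projection along the diagonal, then radial projection; both commute with
  permutations of the coordinates.\<close>

definition retract_sphere :: "nat \<Rightarrow> (nat \<Rightarrow> real) \<Rightarrow> (nat \<Rightarrow> real)" where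
  "retract_sphere n x = normalize_vec n (center n x)"

lemma retract_sphere_in:
  assumes "x \<in> nonconst n"
  shows "retract_sphere n x \<in> unit_sphere n"
proof -
  have "n > 0"
    using assms by (auto simp: nonconst_def)
  then show ?thesis
    unfolding retract_sphere_def
    using assms center_in_hyperplane inner_n_center_nonzero normalize_vec_in_unit_sphere by blast
qed

lemma retract_sphere_permute:
  "p permutes {1..n} \<Longrightarrow> retract_sphere n (x \<circ> p) = retract_sphere n x \<circ> p"
  by (simp add: retract_sphere_def center_permute normalize_vec_permute)

lemma continuous_on_normalize_vec:
  fixes f :: "'a::topological_space \<Rightarrow> nat \<Rightarrow> real"
  assumes "continuous_on S f" "\<And>x. x \<in> S \<Longrightarrow> inner_n n (f x) (f x) \<noteq> 0"
  shows "continuous_on S (\<lambda>x. normalize_vec n (f x))"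
  unfolding normalize_vec_def using assms inner_n_self_nonneg
  by (intro continuous_intros continuous_on_product_then_coordinatewise[OF assms(1)]) auto

lemma continuous_on_retract_sphere: "continuous_on (nonconst n) (retract_sphere n)"
  unfolding retract_sphere_def
  by (rule continuous_on_normalize_vec[OF continuous_on_center[OF continuous_on_id]])
    (rule inner_n_center_nonzero)

lemma unit_sphere_permute:
  assumes "p permutes {1..n}" "x \<in> unit_sphere n"
  shows "x \<circ> inv' p \<in> unit_sphere n"
proof -
  have "(\<Sum>i=1..n. (x \<circ> inv' p) i) = (\<Sum>i=1..n. x i)"
    using sum.permute[OF permutes_inv[OF assms(1)], of x] by simp
  then show ?thesis
    using assms permutes_in_image[OF permutes_inv[OF assms(1)]]
    by (auto simp: unit_sphere_def hyperplane_def inner_n_permute permutes_inv)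
qed

text \<open>The new map extends not \<open>f\<close> but \<open>R \<circ> f\<close>, where
  \<open>R\<close> is \<Phi> followed by the retraction onto the sphere. The Tietze extension of
  \<open>f\<close> over \<open>K\<close> may leave the sphere, but \<open>R\<close> is defined
  everywhere; equivariance then dictates the values on the translates. They agree with
  \<open>R \<circ> f\<close> on \<open>Z\<close> because \<open>R\<close> is equivariant on the
  sphere, and distinct translates are disjoint.\<close>

lemma extend_over_translates:
  fixes X :: "'a topology" and act :: "(nat \<Rightarrow> nat) \<Rightarrow> 'a \<Rightarrow> 'a"
  assumes "compact_space X" "Hausdorff_space X"
    and act: "\<And>p. p permutes {1..n} \<Longrightarrow> continuous_map X X (act p)"
    and act_id: "\<And>x. x \<in> topspace X \<Longrightarrow> act id x = x"
    and act_comp: "\<And>p q x. \<lbrakk>p permutes {1..n}; q permutes {1..n}; x \<in> topspace X\<rbrakk>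
      \<Longrightarrow> act (p \<circ> q) x = act p (act q x)"
    and K: "closedin X K"
    and K_disj: "\<And>p. \<lbrakk>p permutes {1..n}; p \<noteq> id\<rbrakk> \<Longrightarrow> act p ` K \<inter> K = {}"
    and Z: "closedin X Z" and Z_inv: "\<And>p. p permutes {1..n} \<Longrightarrow> act p ` Z \<subseteq> Z"
    and f: "continuous_map (subtopology X Z) euclidean f" "f ` Z \<subseteq> unit_sphere n"
    and f_eq: "\<And>p x. \<lbrakk>p permutes {1..n}; x \<in> Z\<rbrakk> \<Longrightarrow> f (act p x) = f x \<circ> inv' p"
    and \<Phi>: "continuous_on UNIV \<Phi>" "range \<Phi> \<subseteq> nonconst n"
    and \<Phi>_eq: "\<And>p x. \<lbrakk>p permutes {1..n}; x \<in> unit_sphere n\<rbrakk> \<Longrightarrow> \<Phi> (x \<circ> inv' p) = \<Phi> x \<circ> inv' p"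
  defines "Z' \<equiv> Z \<union> (\<Union>p\<in>{p. p permutes {1..n}}. act p ` K)"
  shows "closedin X Z'" "\<And>p. p permutes {1..n} \<Longrightarrow> act p ` Z' \<subseteq> Z'"
    "\<exists>f'. continuous_map (subtopology X Z') euclidean f' \<and> f' ` Z' \<subseteq> unit_sphere n \<and>
       (\<forall>p x. p permutes {1..n} \<longrightarrow> x \<in> Z' \<longrightarrow> f' (act p x) = f' x \<circ> inv' p)"
proof -
  let ?G = "{p. p permutes {1..n}}"
  have fin: "finite ?G"
    by (simp add: finite_permutations)
  have KX: "K \<subseteq> topspace X" and ZX: "Z \<subseteq> topspace X"
    using K Z by (auto dest: closedin_subset)
  have clo: "closedin X (act p ` K)" if "p permutes {1..n}" for p
    using assms(1,2) K act[OF that]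
    by (meson closedin_compact_space compactin_imp_closedin image_compactin)
  show cloZ': "closedin X Z'"
    unfolding Z'_def using fin clo Z by (intro closedin_Un closedin_Union) auto
  show inv: "act p ` Z' \<subseteq> Z'" if p: "p permutes {1..n}" for p
  proof -
    have "act p (act q x) \<in> Z'" if "q permutes {1..n}" "x \<in> K" for q x
    proof -
      have "act p (act q x) = act (p \<circ> q) x"
        using act_comp p that KX by auto
      then show ?thesis
        using permutes_compose[OF that(1) p] that unfolding Z'_def by blast
    qed
    then show ?thesis
      using Z_inv[OF p] unfolding Z'_def by blast
  qed
  have Z'X: "Z' \<subseteq> topspace X"
    using cloZ' closedin_subset by blast
  have cancel: "act (inv' p) (act p x) = x" if "p permutes {1..n}" "x \<in> topspace X" for p x
    using that act_comp[of "inv' p" p x] act_id by (simp add: permutes_inv permutes_inv_o)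
  have "normal_space X"
    using assms(1,2) compact_Hausdorff_or_regular_imp_normal_space by blast
  have "\<exists>e. continuous_map X euclideanreal e \<and> (\<forall>x\<in>K \<inter> Z. e x = f x i)" for i
  proof -
    have "continuous_map (subtopology X Z) (product_topology (\<lambda>_. euclideanreal) UNIV) f"
      using f(1) by (simp add: euclidean_product_topology)
    then have "continuous_map (subtopology X Z) euclideanreal (\<lambda>x. f x i)"
      by (rule continuous_map_product_then_coordinatewise) simp
    then have "continuous_map (subtopology X (K \<inter> Z)) euclideanreal (\<lambda>x. f x i)"
      by (metis continuous_map_from_subtopology inf_commute subtopology_subtopology)
    then show ?thesis
      using \<open>normal_space X\<close> closedin_Int[OF K Z] unfolding normal_space_iff_Tietze by simp
  qed
  then obtain e where e: "\<And>i. continuous_map X euclideanreal (e i)"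
    "\<And>i x. x \<in> K \<inter> Z \<Longrightarrow> e i x = f x i"
    by metis
  define u where "u x = (\<lambda>i. e i x)" for x
  have u: "continuous_map X euclidean u"
    unfolding u_def euclidean_product_topology[symmetric] using e(1) by auto
  have uf: "u x = f x" if "x \<in> K \<inter> Z" for x
    using e(2)[OF that] by (auto simp: u_def)
  define R where "R = retract_sphere n \<circ> \<Phi>"
  have "continuous_on UNIV R"
    unfolding R_def using \<Phi> continuous_on_retract_sphere
    by (intro continuous_on_compose) (auto intro: continuous_on_subset)
  then have R: "continuous_map euclidean euclidean R"
    by simp
  have R_in: "R x \<in> unit_sphere n" for x
    using \<Phi>(2) retract_sphere_in by (auto simp: R_def)
  have R_eq: "R (x \<circ> inv' p) = R x \<circ> inv' p" if "p permutes {1..n}" "x \<in> unit_sphere n" for p x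
    using that by (simp add: R_def \<Phi>_eq retract_sphere_permute permutes_inv)
  \<comment> \<open>Index \<open>None\<close> stands for the piece \<open>Z\<close>, and
    \<open>Some p\<close> for the translate of \<open>K\<close> by \<open>p\<close>: there a point
    is moved back to \<open>K\<close>, mapped, and the value permuted.\<close>
  define F where "F k = (case k of None \<Rightarrow> R \<circ> f
     | Some p \<Rightarrow> (\<lambda>x. R (u (act (inv' p) x)) \<circ> inv' p))" for k
  define T where "T k = (case k of None \<Rightarrow> Z | Some p \<Rightarrow> act p ` K)" for k
  let ?I = "insert None (Some ` ?G)"
  have FZ: "F k x = R (f x)" if k: "k \<in> ?I" "x \<in> T k" "x \<in> Z" for k x
  proof (cases k)
    case (Some p)
    then have p: "p permutes {1..n}" and "x \<in> act p ` K"
      using k by (auto simp: T_def)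
    then obtain y where y: "y \<in> K" "x = act p y"
      by blast
    have y': "act (inv' p) x = y"
      using y KX cancel p by auto
    then have "y \<in> Z"
      using Z_inv[OF permutes_inv[OF p]] k(3) by blast
    then have "F k x = R (f y) \<circ> inv' p"
      using Some y y' uf by (simp add: F_def)
    also have "\<dots> = R (f x)"
      using R_eq[OF p] f(2) \<open>y \<in> Z\<close> f_eq[OF p \<open>y \<in> Z\<close>] y(2) by auto
    finally show ?thesis .
  qed (use that in \<open>simp add: F_def\<close>)
  have disj: "p = q" if pq: "p permutes {1..n}" "q permutes {1..n}" "x \<in> act p ` K" "x \<in> act q ` K" for p q x
  proof (rule ccontr)
    assume "p \<noteq> q"
    obtain y z where yz: "y \<in> K" "z \<in> K" "act p y = act q z"
      using pq by blast
    have "act (inv' q \<circ> p) y = act (inv' q) (act q z)"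
      using yz KX act_comp[OF permutes_inv[OF pq(2)] pq(1), of y] by auto
    also have "\<dots> = z"
      using yz(2) KX cancel[OF pq(2)] by blast
    finally have "z \<in> act (inv' q \<circ> p) ` K"
      using yz(1) by blast
    moreover have "inv' q \<circ> p \<noteq> id"
      using \<open>p \<noteq> q\<close> pq by (metis comp_assoc comp_id id_comp permutes_inv_o(1))
    ultimately show False
      using K_disj[OF permutes_compose[OF pq(1) permutes_inv[OF pq(2)]]] yz(2) by auto
  qed
  let ?X = "subtopology X Z'"
  obtain g where g: "continuous_map ?X euclidean g"
    and gF': "\<And>x k. \<lbrakk>k \<in> ?I; x \<in> topspace ?X \<inter> T k\<rbrakk> \<Longrightarrow> g x = F k x"
  proof (rule pasting_lemma_exists_closed)
    show "finite ?I"
      using fin by simp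
    show "topspace ?X \<subseteq> \<Union> (T ` ?I)"
      by (auto simp: T_def Z'_def)
    have T: "T k \<subseteq> Z'" "closedin X (T k)" if "k \<in> ?I" for k
      using that clo Z by (auto simp: T_def Z'_def)
    show "closedin ?X (T k)" if "k \<in> ?I" for k
      using T[OF that] closedin_subset_topspace by blast
    show "continuous_map (subtopology ?X (T k)) euclidean (F k)" if k: "k \<in> ?I" for k
    proof -
      have eq: "subtopology ?X (T k) = subtopology X (T k)"
        using T(1)[OF k] by (simp add: subtopology_subtopology inf.absorb2)
      show ?thesis
      proof (cases k)
        case None
        then show ?thesis
          unfolding eq using f(1) R by (auto simp: F_def T_def intro: continuous_map_compose)
      next
        case (Some p)
        then have p: "p permutes {1..n}"
          using k by auto
        have "continuous_map X euclidean (R \<circ> (u \<circ> act (inv' p)))"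
          by (intro continuous_map_compose[OF _ R] continuous_map_compose[OF _ u] act permutes_inv p)
        then have "continuous_map X (product_topology (\<lambda>_. euclideanreal) UNIV) (R \<circ> (u \<circ> act (inv' p)))"
          by (simp add: euclidean_product_topology)
        then have "continuous_map X euclideanreal (\<lambda>x. (R \<circ> (u \<circ> act (inv' p))) x i)" for i
          by (rule continuous_map_product_then_coordinatewise) simp
        then have "continuous_map X (product_topology (\<lambda>_. euclideanreal) UNIV) (F k)"
          by (intro continuous_map_coordinatewise_then_product) (auto simp: Some F_def)
        then show ?thesis
          unfolding eq by (simp add: euclidean_product_topology continuous_map_from_subtopology)
      qed
    qed
    show "F k x = F l x" if kl: "k \<in> ?I" "l \<in> ?I" "x \<in> topspace ?X \<inter> T k \<inter> T l" for k l x
    proof (cases "x \<in> Z")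
      case True
      then show ?thesis
        using FZ kl by auto
    next
      case False
      then have "k = l"
        using kl disj by (auto simp: T_def)
      then show ?thesis
        by simp
    qed
  next
    fix g
    assume g: "continuous_map ?X euclidean g"
      "\<And>x k. \<lbrakk>k \<in> ?I; x \<in> topspace ?X \<inter> T k\<rbrakk> \<Longrightarrow> g x = F k x"
    show thesis
      by (rule that[OF g])
  qed
  have gF: "g x = F k x" if "k \<in> ?I" "x \<in> T k" "x \<in> Z'" for x k
    using gF'[of k x] that Z'X by auto
  have gZ: "g x = R (f x)" if "x \<in> Z" for x
    using gF[of None x] that by (simp add: F_def T_def Z'_def)
  have gK: "g (act p y) = R (u y) \<circ> inv' p" if "p permutes {1..n}" "y \<in> K" for p y
  proof -
    have "g (act p y) = F (Some p) (act p y)"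
      using that by (intro gF) (auto simp: T_def Z'_def)
    then show ?thesis
      using that(2) KX cancel[OF that(1), of y] by (auto simp: F_def)
  qed
  have "g x \<in> unit_sphere n" if "x \<in> Z'" for x
    using that unfolding Z'_def
  proof
    assume "x \<in> (\<Union>p\<in>?G. act p ` K)"
    then show ?thesis
      using gK R_in unit_sphere_permute by force
  qed (simp add: gZ R_in)
  moreover have "g (act p x) = g x \<circ> inv' p" if p: "p permutes {1..n}" and x: "x \<in> Z'" for p x
  proof (cases "x \<in> Z")
    case True
    then have "act p x \<in> Z"
      using Z_inv[OF p] by blast
    then have "g (act p x) = R (f x \<circ> inv' p)"
      using gZ f_eq[OF p True] by simp
    also have "\<dots> = g x \<circ> inv' p"
      using R_eq[OF p, of "f x"] f(2) True gZ by (simp add: image_subset_iff)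
    finally show ?thesis .
  next
    case False
    then obtain q y where q: "q permutes {1..n}" "y \<in> K" "x = act q y"
      using x unfolding Z'_def by blast
    have "act p x = act (p \<circ> q) y"
      using q KX act_comp[OF p q(1), of y] by auto
    then have "g (act p x) = R (u y) \<circ> inv' (p \<circ> q)"
      using gK[OF permutes_compose[OF q(1) p] q(2)] by simp
    also have "\<dots> = g x \<circ> inv' p"
      using gK[OF q(1,2)] q(3) o_inv_distrib[of p q] permutes_bij[OF p] permutes_bij[OF q(1)]
      by (simp add: comp_assoc)
    finally show ?thesis .
  qed
  ultimately show "\<exists>f'. continuous_map ?X euclidean f' \<and> f' ` Z' \<subseteq> unit_sphere n \<and>
       (\<forall>p x. p permutes {1..n} \<longrightarrow> x \<in> Z' \<longrightarrow> f' (act p x) = f' x \<circ> inv' p)"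
    using g by blast
qed

section \<open>Equivariant bump maps of the sphere\<close>

text \<open>A bump of weight \<open>j\<close> at a point \<open>a\<close> maps \<open>x\<close> to \<open>bump_id j r * x + bump_pt j r * a\<close>, where \<open>r\<close> runs from 0 at
  \<open>a\<close> to 1 at the boundary of the bump. Sum and difference of the two coefficients are \<open>sqrt 2\<close> times the
  cosine and sine of \<open>bump_angle j r\<close>; for \<open>r = 0\<close>, where \<open>x = a\<close>, only the cosine matters, so that the
  angle may be any multiple of \<open>pi\<close>.\<close>

definition bump_angle :: "int \<Rightarrow> real \<Rightarrow> real" where
  "bump_angle j r = (1 - r) * (of_int j * pi) + r * (pi / 4)"

definition bump_id :: "int \<Rightarrow> real \<Rightarrow> real" where
  "bump_id j r = sqrt 2 * (cos (bump_angle j r) + sin (bump_angle j r)) / 2"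

definition bump_pt :: "int \<Rightarrow> real \<Rightarrow> real" where
  "bump_pt j r = sqrt 2 * (cos (bump_angle j r) - sin (bump_angle j r)) / 2"

lemma bump_1 [simp]: "bump_id j 1 = 1" "bump_pt j 1 = 0"
proof -
  have "sqrt 2 * (sqrt 2 / 2 + sqrt 2 / 2) / 2 = (1::real)"
    by (simp add: power2_eq_square[symmetric])
  then show "bump_id j 1 = 1" "bump_pt j 1 = 0"
    by (simp_all add: bump_id_def bump_pt_def bump_angle_def sin_45 cos_45)
qed

lemma continuous_on_bump [continuous_intros]:
  fixes f :: "'a::t2_space \<Rightarrow> real"
  assumes "continuous_on S f"
  shows "continuous_on S (\<lambda>x. bump_id j (f x))" "continuous_on S (\<lambda>x. bump_pt j (f x))"
  unfolding bump_id_def bump_pt_def bump_angle_def divide_inverse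
  by (intro continuous_intros assms)+

lemma bump_nonzero: "bump_id j r \<noteq> 0 \<or> bump_pt j r \<noteq> 0"
proof (rule ccontr)
  let ?a = "bump_angle j r"
  assume "\<not> ?thesis"
  then have "cos ?a = 0" "sin ?a = 0"
    by (auto simp: bump_id_def bump_pt_def)
  then show False
    using sin_cos_squared_add[of ?a] by simp
qed

lemma sin_cos_int_times_pi: "sin (of_int j * pi) = 0" "(cos (of_int j * pi))\<^sup>2 = 1"
proof -
  show s: "sin (of_int j * pi) = 0"
    using sin_integer_2pi sin_zero_iff_int2 by blast
  then show "(cos (of_int j * pi))\<^sup>2 = 1"
    using sin_cos_squared_add[of "of_int j * pi"] by simp
qed

lemma bump_0: "bump_id j 0 = bump_pt j 0" "bump_pt j 0 \<noteq> 0"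
proof -
  have "cos (of_int j * pi) \<noteq> 0"
    using sin_cos_int_times_pi(2)[of j] by (metis power_zero_numeral zero_neq_one)
  then show "bump_id j 0 = bump_pt j 0" "bump_pt j 0 \<noteq> 0"
    using sin_cos_int_times_pi(1)[of j] by (auto simp: bump_id_def bump_pt_def bump_angle_def)
qed

text \<open>On the unit sphere \<open>1 - inner_n n x a\<close> is half the squared distance of
  \<open>x\<close> and \<open>a\<close>, so the bump at \<open>a\<close> is a round cap whose size
  is governed by \<delta>.\<close>

definition bump_radius :: "nat \<Rightarrow> real \<Rightarrow> (nat \<Rightarrow> real) \<Rightarrow> (nat \<Rightarrow> real) \<Rightarrow> real" where
  "bump_radius n \<delta> x a = min 1 ((1 - inner_n n x a) / \<delta>)"

text \<open>Each bump contributes \<open>bump_id - 1\<close> here and \<open>bump_pt\<close> below,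
  both 0 where its radius is 1. Summation thus gives one continuous formula for a map that is
  defined cap by cap.\<close>

definition twist_coeff ::
    "nat \<Rightarrow> real \<Rightarrow> 'b set \<Rightarrow> ('b \<Rightarrow> int) \<Rightarrow> ('b \<Rightarrow> nat \<Rightarrow> real) \<Rightarrow> (nat \<Rightarrow> real) \<Rightarrow> real" where
  "twist_coeff n \<delta> B j c x = 1 + (\<Sum>b\<in>B. bump_id (j b) (bump_radius n \<delta> x (c b)) - 1)"

definition twist ::
    "nat \<Rightarrow> real \<Rightarrow> 'b set \<Rightarrow> ('b \<Rightarrow> int) \<Rightarrow> ('b \<Rightarrow> nat \<Rightarrow> real) \<Rightarrow> (nat \<Rightarrow> real) \<Rightarrow> nat \<Rightarrow> real" where
  "twist n \<delta> B j c x = (\<lambda>i. twist_coeff n \<delta> B j c x * x i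
     + (\<Sum>b\<in>B. bump_pt (j b) (bump_radius n \<delta> x (c b)) * c b i))"

definition separated :: "nat \<Rightarrow> real \<Rightarrow> 'b set \<Rightarrow> ('b \<Rightarrow> nat \<Rightarrow> real) \<Rightarrow> bool" where
  "separated n \<delta> B c \<longleftrightarrow> c ` B \<subseteq> unit_sphere n \<and>
     (\<forall>a\<in>B. \<forall>b\<in>B. a \<noteq> b \<longrightarrow> 4 * \<delta> \<le> 1 - inner_n n (c a) (c b))"

text \<open>The squared norm of \<open>2 x - a - b\<close> is nonnegative. This is where the factor
  4 in \<open>separated\<close> comes from: it makes the caps around different centres
  disjoint.\<close>

lemma sphere_triangle:
  assumes "x \<in> unit_sphere n" "a \<in> unit_sphere n" "b \<in> unit_sphere n"
  shows "1 - inner_n n a b \<le> 2 * (1 - inner_n n x a) + 2 * (1 - inner_n n x b)"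
proof -
  have "0 \<le> inner_n n (\<lambda>i. 2 * x i - a i - b i) (\<lambda>i. 2 * x i - a i - b i)"
    by (rule inner_n_self_nonneg)
  also have "\<dots> = 4 * inner_n n x x + inner_n n a a + inner_n n b b
      - 4 * inner_n n x a - 4 * inner_n n x b + 2 * inner_n n a b"
    unfolding inner_n_def sum_distrib_left sum.distrib[symmetric] sum_subtractf[symmetric]
    by (intro sum.cong) (auto simp: algebra_simps)
  finally show ?thesis
    using assms by (simp add: unit_sphere_def)
qed

lemma bump_radius_eq_1_or_unique:
  assumes "separated n \<delta> B c" "0 < \<delta>" "x \<in> unit_sphere n"
  obtains "\<And>b. b \<in> B \<Longrightarrow> bump_radius n \<delta> x (c b) = 1"
  | a where "a \<in> B" "1 - inner_n n x (c a) < \<delta>" "\<And>b. b \<in> B - {a} \<Longrightarrow> bump_radius n \<delta> x (c b) = 1"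
proof (cases "\<exists>a\<in>B. 1 - inner_n n x (c a) < \<delta>")
  case True
  then obtain a where a: "a \<in> B" "1 - inner_n n x (c a) < \<delta>"
    by blast
  have "bump_radius n \<delta> x (c b) = 1" if "b \<in> B - {a}" for b
  proof -
    have "4 * \<delta> \<le> 1 - inner_n n (c a) (c b)"
      using assms(1) a(1) that by (auto simp: separated_def)
    also have "\<dots> \<le> 2 * (1 - inner_n n x (c a)) + 2 * (1 - inner_n n x (c b))"
      using assms(1,3) a(1) that by (intro sphere_triangle) (auto simp: separated_def)
    finally have "\<delta> \<le> 1 - inner_n n x (c b)"
      using a(2) by simp
    then show ?thesis
      using assms(2) by (simp add: bump_radius_def)
  qed
  then show ?thesis
    using a that(2) by blast
next
  case False
  then have "bump_radius n \<delta> x (c b) = 1" if "b \<in> B" for b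
    using that assms(2) by (auto simp: bump_radius_def min_def not_less field_simps)
  then show ?thesis
    using that(1) by blast
qed

lemma twist_eq:
  assumes "finite B"
  shows "(\<And>b. b \<in> B \<Longrightarrow> bump_radius n \<delta> x (c b) = 1) \<Longrightarrow> twist n \<delta> B j c x = x"
    and "a \<in> B \<Longrightarrow> (\<And>b. b \<in> B - {a} \<Longrightarrow> bump_radius n \<delta> x (c b) = 1) \<Longrightarrow>
      twist n \<delta> B j c x = (\<lambda>i. bump_id (j a) (bump_radius n \<delta> x (c a)) * x i
        + bump_pt (j a) (bump_radius n \<delta> x (c a)) * c a i)"
proof -
  assume *: "\<And>b. b \<in> B \<Longrightarrow> bump_radius n \<delta> x (c b) = 1"
  show "twist n \<delta> B j c x = x"
    by (simp add: twist_def twist_coeff_def * cong: sum.cong)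
next
  assume a: "a \<in> B" and *: "\<And>b. b \<in> B - {a} \<Longrightarrow> bump_radius n \<delta> x (c b) = 1"
  show "twist n \<delta> B j c x = (\<lambda>i. bump_id (j a) (bump_radius n \<delta> x (c a)) * x i
        + bump_pt (j a) (bump_radius n \<delta> x (c a)) * c a i)"
  proof -
    have "(\<Sum>b\<in>B - {a}. bump_id (j b) (bump_radius n \<delta> x (c b)) - 1) = 0"
      "(\<Sum>b\<in>B - {a}. bump_pt (j b) (bump_radius n \<delta> x (c b)) * c b i) = 0" for i
      using * by (auto intro!: sum.neutral)
    then show ?thesis
      using assms a by (simp add: twist_def twist_coeff_def sum.remove[of B a])
  qed
qed

lemma twist_in_hyperplane:
  assumes "c ` B \<subseteq> hyperplane n" "x \<in> hyperplane n"
  shows "twist n \<delta> B j c x \<in> hyperplane n"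
proof -
  have "(\<Sum>i=1..n. \<Sum>b\<in>B. bump_pt (j b) (bump_radius n \<delta> x (c b)) * c b i)
      = (\<Sum>b\<in>B. bump_pt (j b) (bump_radius n \<delta> x (c b)) * (\<Sum>i=1..n. c b i))"
    unfolding sum_distrib_left by (rule sum.swap)
  also have "\<dots> = 0"
    using assms(1) by (intro sum.neutral) (auto simp: hyperplane_def)
  finally show ?thesis
    using assms by (auto simp: hyperplane_def twist_def sum.distrib image_subset_iff
        simp flip: sum_distrib_left)
qed

text \<open>A constant vector in the hyperplane is 0, so a bump would give a vanishing combination
  of \<open>x\<close> and its centre. The coefficients have no common zero, so \<open>x\<close>
  would be the centre or its antipode. The antipode is outside the cap, as \<delta> < 1, and at the
  centre the two coefficients are equal and nonzero.\<close>

lemma twist_nonconst: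
  assumes "separated n \<delta> B c" "0 < \<delta>" "\<delta> < 1" "x \<in> unit_sphere n" "finite B"
  shows "twist n \<delta> B j c x \<in> nonconst n"
proof -
  have cB: "c ` B \<subseteq> unit_sphere n"
    using assms(1) by (simp add: separated_def)
  show ?thesis
    using assms(1,2,4)
  proof (cases rule: bump_radius_eq_1_or_unique)
    case 1
    then show ?thesis
      using twist_eq(1)[OF assms(5)] assms(4) unit_sphere_subset_nonconst by fastforce
  next
    case (2 a)
    let ?r = "bump_radius n \<delta> x (c a)" and ?t = "inner_n n x (c a)"
    let ?L = "bump_id (j a) ?r" and ?M = "bump_pt (j a) ?r"
    have eq: "twist n \<delta> B j c x = (\<lambda>i. ?L * x i + ?M * c a i)"
      using 2 by (intro twist_eq(2)[OF assms(5)])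
    show ?thesis
    proof (rule ccontr)
      assume "twist n \<delta> B j c x \<notin> nonconst n"
      moreover have "twist n \<delta> B j c x \<in> hyperplane n"
        using assms(4) cB by (intro twist_in_hyperplane) (auto simp: unit_sphere_def)
      ultimately have "(\<lambda>i. ?L * x i + ?M * c a i) = (\<lambda>i. 0 * x i)"
        using hyperplane_const_imp_0 unfolding eq by fastforce
      then have z: "inner_n n y (\<lambda>i. ?L * x i + ?M * c a i) = 0" for y
        by (simp add: inner_n_def)
      have "?L * inner_n n y x + ?M * inner_n n y (c a) = 0" for y
        using z[of y] by (simp add: inner_n_add_right inner_n_scale_right)
      from this[of x] this[of "c a"] have LM: "?L + ?M * ?t = 0" "?L * ?t + ?M = 0"
        using assms(4) cB 2(1) by (auto simp: unit_sphere_def inner_n_commute)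
      \<comment> \<open>Inside the cap \<open>?t > 1 - \<delta> > 0\<close>, so the factor
        \<open>1 + ?t\<close> can be cancelled.\<close>
      have "(?L + ?M) * (1 + ?t) = (?L + ?M * ?t) + (?L * ?t + ?M)"
        by (simp add: algebra_simps)
      then have "?L = - ?M"
        using LM 2(2) assms(3) by (simp add: add_eq_0_iff)
      then have "?M \<noteq> 0" "?M * (?t - 1) = 0"
        using bump_nonzero[of "j a" ?r] LM(1) by (auto simp: algebra_simps)
      then have "?r = 0"
        by (simp add: bump_radius_def)
      then show False
        using \<open>?L = - ?M\<close> bump_0[of "j a"] by simp
    qed
  qed
qed

lemma continuous_on_bump_radius [continuous_intros]:
  fixes f g :: "'a::t2_space \<Rightarrow> nat \<Rightarrow> real"
  assumes "continuous_on S f" "continuous_on S g"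
  shows "continuous_on S (\<lambda>x. bump_radius n \<delta> (f x) (g x))"
  unfolding bump_radius_def divide_inverse by (intro continuous_intros assms)

lemma continuous_on_twist_coeff:
  fixes f :: "'a::t2_space \<Rightarrow> nat \<Rightarrow> real"
  assumes "continuous_on S f" "\<And>b. b \<in> B \<Longrightarrow> continuous_on S (\<lambda>s. c s b)"
  shows "continuous_on S (\<lambda>s. twist_coeff n \<delta> B j (c s) (f s))"
  unfolding twist_coeff_def by (intro continuous_intros assms)

lemma continuous_on_twist:
  fixes f :: "'a::t2_space \<Rightarrow> nat \<Rightarrow> real"
  assumes "continuous_on S f" "\<And>b. b \<in> B \<Longrightarrow> continuous_on S (\<lambda>s. c s b)"
  shows "continuous_on S (\<lambda>s. twist n \<delta> B j (c s) (f s))"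
  unfolding twist_def
  by (intro continuous_on_coordinatewise_then_product continuous_on_add continuous_on_mult
      continuous_on_sum continuous_on_bump continuous_on_bump_radius continuous_on_twist_coeff
      continuous_on_product_then_coordinatewise[OF assms(1)]
      continuous_on_product_then_coordinatewise[OF assms(2)] assms)

section \<open>Moving the bumps into a plane\<close>

text \<open>The powers of \<open>2n + 1\<close> make \<open>plane_coord\<close> map the indicator functions of different proper
  subsets to different rays, since the digits of the imaginary part can be read off.\<close>

definition weight :: "nat \<Rightarrow> nat \<Rightarrow> complex" where
  "weight n i = Complex 1 (real (2 * n + 1) ^ i)"

definition plane_coord :: "nat \<Rightarrow> (nat \<Rightarrow> real) \<Rightarrow> complex" where
  "plane_coord n x = (\<Sum>i\<in>{1..<n}. weight n i * of_real (x i - x n))"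

definition indic :: "nat set \<Rightarrow> nat \<Rightarrow> real" where
  "indic A i = (if i \<in> A then 1 else 0)"

text \<open>The vector with last coordinate 0 that has the plane coordinate \<open>z\<close> and the coordinates \<open>y j\<close> for
  \<open>3 \<le> j < n\<close>; its first two coordinates solve a linear system.\<close>

definition vec_of :: "nat \<Rightarrow> complex \<Rightarrow> (nat \<Rightarrow> real) \<Rightarrow> nat \<Rightarrow> real" where
  "vec_of n z y = (let r = z - (\<Sum>j\<in>{3..<n}. weight n j * of_real (y j));
       K = real (2 * n + 1); s = (Im r - K * Re r) / (K\<^sup>2 - K)
     in (\<lambda>i. if i = 1 then Re r - s else if i = 2 then s else if i \<in> {3..<n} then y i else 0))"

text \<open>A linear section of \<open>plane_coord\<close> with values in the hyperplane. For
  \<open>n \<ge> 3\<close> its image is the plane into which the bumps are moved: the vectors of the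
  hyperplane whose coordinates from 3 to \<open>n\<close> all agree.\<close>

definition plane_vec :: "nat \<Rightarrow> complex \<Rightarrow> nat \<Rightarrow> real" where
  "plane_vec n z = center n (vec_of n z (\<lambda>_. 0))"

lemma sum_split_12:
  fixes n :: nat
  assumes "n \<ge> 3"
  shows "(\<Sum>i\<in>{1..<n}. f i) = f 1 + f 2 + (\<Sum>i\<in>{3..<n}. f i :: 'a::comm_monoid_add)"
proof -
  have "{1..<n} = {1, 2} \<union> {3..<n}"
    using assms by auto
  then show ?thesis
    by (simp add: sum.union_disjoint add_ac)
qed

text \<open>This is the determinant of the linear system for the first two coordinates in
  \<open>vec_of\<close>.\<close>

lemma weight_square_gap: "n \<ge> 1 \<Longrightarrow> (real (2 * n + 1))\<^sup>2 - real (2 * n + 1) \<noteq> 0"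
proof -
  assume "n \<ge> 1"
  moreover have "(real (2 * n + 1))\<^sup>2 - real (2 * n + 1) = real (2 * n + 1) * real (2 * n)"
    by (simp add: power2_eq_square algebra_simps)
  ultimately show ?thesis
    by simp
qed

lemma plane_coord_vec_of:
  assumes "n \<ge> 3"
  shows "plane_coord n (vec_of n z y) = z"
proof -
  define r where "r = z - (\<Sum>j\<in>{3..<n}. weight n j * of_real (y j))"
  define K where "K = real (2 * n + 1)"
  define s where "s = (Im r - K * Re r) / (K\<^sup>2 - K)"
  have v: "vec_of n z y = (\<lambda>i. if i = 1 then Re r - s else if i = 2 then s
      else if i \<in> {3..<n} then y i else 0)"
    by (simp only: vec_of_def r_def K_def s_def Let_def)
  have w: "weight n i = Complex 1 (K ^ i)" for i
    by (simp only: weight_def K_def)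
  have "(K\<^sup>2 - K) * s = Im r - K * Re r"
    using weight_square_gap[of n] assms by (simp add: s_def K_def)
  then have "weight n 1 * of_real (Re r - s) + weight n 2 * of_real s = r"
    by (simp add: w complex_eq_iff algebra_simps)
  moreover have "(\<Sum>i\<in>{3..<n}. weight n i * of_real (vec_of n z y i - vec_of n z y n))
      = (\<Sum>i\<in>{3..<n}. weight n i * of_real (y i))"
    using assms by (intro sum.cong) (auto simp: v)
  ultimately show ?thesis
    using assms unfolding plane_coord_def sum_split_12[OF assms] by (simp add: v r_def)
qed

lemma vec_of_coord:
  assumes "n \<ge> 3"
  shows "j \<in> {3..<n} \<Longrightarrow> vec_of n z y j = y j" "vec_of n z y n = 0"
  using assms by (auto simp: vec_of_def Let_def)

lemma plane_coord_linear: "plane_coord n (\<lambda>i. a * x i + b * y i) = of_real a * plane_coord n x + of_real b * plane_coord n y"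
  by (simp add: plane_coord_def sum_distrib_left sum.distrib[symmetric] algebra_simps)

lemma plane_coord_center: "plane_coord n (center n x) = plane_coord n x"
  by (auto simp: plane_coord_def center_def intro!: sum.cong)

lemma nonconst_if_coords:
  assumes "n \<ge> 1" "plane_coord n x \<noteq> 0 \<or> (\<exists>j\<in>{3..<n}. x j \<noteq> x n)"
  shows "x \<in> nonconst n"
proof (rule ccontr)
  assume "x \<notin> nonconst n"
  then have eq: "x i - x n = 0" if "i \<in> {1..n}" for i
    using that assms(1) unfolding nonconst_def by force
  have "plane_coord n x = (\<Sum>i\<in>{1..<n}. 0)"
    unfolding plane_coord_def by (intro sum.cong) (simp_all add: eq)
  moreover have "\<forall>j\<in>{3..<n}. x j = x n"
  proof
    fix j
    assume "j \<in> {3..<n}"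
    then have "j \<in> {1..n}"
      by simp
    from eq[OF this] show "x j = x n"
      by linarith
  qed
  ultimately have "plane_coord n x = 0" "\<forall>j\<in>{3..<n}. x j = x n"
    by simp_all
  then show False
    using assms(2) by simp
qed

text \<open>The plane coordinate and the \<open>n - 3\<close> differences are \<open>n - 1\<close>
  real coordinates on the hyperplane. Injectivity comes down to the determinant formed by the
  weights 1 and 2.\<close>

lemma hyperplane_eq_0_if_coords:
  assumes n: "n \<ge> 3" and "x \<in> hyperplane n" "plane_coord n x = 0" "\<And>j. j \<in> {3..<n} \<Longrightarrow> x j = x n"
  shows "x i = 0"
proof (rule hyperplane_const_imp_0[OF assms(2)])
  define K where "K = real (2 * n + 1)"
  let ?a = "x 1 - x n" and ?b = "x 2 - x n"
  have "weight n 1 * of_real ?a + weight n 2 * of_real ?b = 0"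
    using assms(3,4) unfolding plane_coord_def sum_split_12[OF n] by simp
  moreover have "weight n i = Complex 1 (K ^ i)" for i
    by (simp only: weight_def K_def)
  ultimately have "?a + ?b = 0" and K0: "K * ?a + K\<^sup>2 * ?b = 0"
    by (simp_all add: complex_eq_iff)
  then have a: "?a = - ?b"
    by linarith
  have "(K\<^sup>2 - K) * ?b = K * - ?b + K\<^sup>2 * ?b"
    by (simp add: algebra_simps)
  then have "(K\<^sup>2 - K) * ?b = 0"
    using K0 unfolding a by simp
  moreover have "K\<^sup>2 - K \<noteq> 0"
    using weight_square_gap[of n] n unfolding K_def by simp
  ultimately have "?b = 0"
    by simp
  with a have "?a = 0"
    by simp
  have "i \<in> {1, 2, n} \<union> {3..<n}" if "i \<in> {1..n}" for i
    using that by auto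
  then have eq: "x i = x n" if "i \<in> {1..n}" for i
    using that assms(4) \<open>?a = 0\<close> \<open>?b = 0\<close> by auto
  show "x \<notin> nonconst n"
  proof
    assume "x \<in> nonconst n"
    then obtain i k where "i \<in> {1..n}" "k \<in> {1..n}" "x i \<noteq> x k"
      unfolding nonconst_def by blast
    then show False
      using eq[of i] eq[of k] by linarith
  qed
qed

lemma plane_coord_plane_vec: "n \<ge> 3 \<Longrightarrow> plane_coord n (plane_vec n z) = z"
  by (simp add: plane_vec_def plane_coord_center plane_coord_vec_of)

lemma plane_vec_in_hyperplane: "n \<ge> 3 \<Longrightarrow> plane_vec n z \<in> hyperplane n"
  by (simp add: plane_vec_def center_in_hyperplane)

lemma plane_vec_coord: "n \<ge> 3 \<Longrightarrow> j \<in> {3..<n} \<Longrightarrow> plane_vec n z j = plane_vec n z n"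
  by (simp add: plane_vec_def center_def vec_of_coord)

lemma hyperplane_lincomb: "x \<in> hyperplane n \<Longrightarrow> y \<in> hyperplane n \<Longrightarrow> (\<lambda>i. a * x i + b * y i) \<in> hyperplane n"
  by (simp add: hyperplane_def sum.distrib flip: sum_distrib_left)

lemma eq_plane_vec:
  assumes "n \<ge> 3" "x \<in> hyperplane n" "\<And>j. j \<in> {3..<n} \<Longrightarrow> x j = x n"
  shows "x = plane_vec n (plane_coord n x)"
proof
  fix i
  have "(\<lambda>i. 1 * x i + (- 1) * plane_vec n (plane_coord n x) i) i = 0"
    using assms plane_vec_coord[OF assms(1)]
    by (intro hyperplane_eq_0_if_coords[OF assms(1)] hyperplane_lincomb plane_vec_in_hyperplane)
      (simp_all only: plane_coord_linear plane_coord_plane_vec, simp_all)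
  then show "x i = plane_vec n (plane_coord n x) i"
    by simp
qed

lemma plane_vec_scale:
  assumes "n \<ge> 3"
  shows "plane_vec n (of_real r * z) = (\<lambda>i. r * plane_vec n z i)"
proof -
  \<comment> \<open>The zero term brings the multiple into the form of
    \<open>hyperplane_lincomb\<close> and \<open>plane_coord_linear\<close>.\<close>
  have "(\<lambda>i. r * plane_vec n z i + 0 * plane_vec n z i) = plane_vec n (plane_coord n (\<lambda>i. r * plane_vec n z i + 0 * plane_vec n z i))"
    using plane_vec_coord[OF assms] by (intro eq_plane_vec assms hyperplane_lincomb plane_vec_in_hyperplane) auto
  then show ?thesis
    by (simp only: plane_coord_linear plane_coord_plane_vec[OF assms]) simp
qed

text \<open>Relative to its last entry an indicator has digits \<open>e A i\<close> in {-1, 0, 1}.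
  The plane coordinate has their sum \<open>s A\<close> as real part and the number with these
  digits in base \<open>2 * n + 1\<close> as imaginary part. Eliminating \<open>r\<close> and
  comparing digits shows that the digits of \<open>A\<close> are \<open>r\<close> times those of
  \<open>B\<close>, and a positive factor between such digits is 1.\<close>

lemma plane_coord_indic_rays:
  assumes A: "A \<in> proper_subsets n" and B: "B \<in> proper_subsets n" and "r > 0"
    and eq: "plane_coord n (indic A) = of_real r * plane_coord n (indic B)"
  shows "A = B"
proof -
  define e :: "nat set \<Rightarrow> nat \<Rightarrow> int" where
    "e A i = (if i \<in> A then 1 else 0) - (if n \<in> A then 1 else 0)" for A i
  define s where "s A = (\<Sum>i\<in>{1..<n}. e A i)" for A
  define K :: int where "K = int (2 * n + 1)"
  have ind: "indic A i - indic A n = of_int (e A i)" for A i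
    by (simp add: indic_def e_def)
  have Re: "Re (plane_coord n (indic A)) = of_int (s A)" for A
    by (simp add: plane_coord_def weight_def ind s_def)
  have Im: "Im (plane_coord n (indic A)) = of_int (\<Sum>i\<in>{1..<n}. e A i * K ^ i)" for A
    by (simp add: plane_coord_def weight_def ind K_def mult.commute)
  have abs_s: "\<bar>s A\<bar> \<le> int n" for A
  proof -
    have "\<bar>s A\<bar> \<le> (\<Sum>i\<in>{1..<n}. \<bar>e A i\<bar>)"
      unfolding s_def by (rule sum_abs)
    also have "\<dots> \<le> (\<Sum>i\<in>{1..<n}. 1)"
      by (intro sum_mono) (auto simp: e_def)
    finally show ?thesis
      by simp
  qed
  have eqR: "of_int (s A) = r * of_int (s B)"
    using arg_cong[OF eq, of Re] by (simp add: Re)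
  have eqI: "of_int (\<Sum>i\<in>{1..<n}. e A i * K ^ i) = r * of_int (\<Sum>i\<in>{1..<n}. e B i * K ^ i)"
    using arg_cong[OF eq, of Im] by (simp add: Im)
  \<comment> \<open>\<open>digits_eq_0\<close> starts at exponent 0, so a zero digit is inserted
    there.\<close>
  define d where "d i = (if i = 0 then 0 else s B * e A i - s A * e B i)" for i
  have "(\<Sum>i<n. d i * K ^ i) = (\<Sum>i\<in>{1..<n}. d i * K ^ i)"
    by (rule sum.mono_neutral_right) (auto simp: d_def)
  also have "\<dots> = s B * (\<Sum>i\<in>{1..<n}. e A i * K ^ i) - s A * (\<Sum>i\<in>{1..<n}. e B i * K ^ i)"
    unfolding sum_distrib_left sum_subtractf[symmetric]
    by (intro sum.cong) (auto simp: d_def algebra_simps)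
  also have "\<dots> = 0"
  proof -
    have "real_of_int (s B * (\<Sum>i\<in>{1..<n}. e A i * K ^ i) - s A * (\<Sum>i\<in>{1..<n}. e B i * K ^ i)) = 0"
      by (simp only: of_int_diff of_int_mult eqR eqI) simp
    then show ?thesis
      by linarith
  qed
  finally have sum0: "(\<Sum>i<n. d i * K ^ i) = 0" .
  have cross: "s B * e A i = s A * e B i" if i: "i \<in> {1..<n}" for i
  proof -
    \<comment> \<open>The base \<open>2 * n + 1\<close> just exceeds the difference of two products
      of absolute value at most \<open>n\<close>.\<close>
    have "\<bar>d k\<bar> < K" for k
    proof -
      have "\<bar>s B * e A k\<bar> \<le> \<bar>s B\<bar> * 1" "\<bar>s A * e B k\<bar> \<le> \<bar>s A\<bar> * 1"
        unfolding abs_mult by (intro mult_left_mono; simp add: e_def)+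
      then have "\<bar>s B * e A k - s A * e B k\<bar> \<le> int n + int n"
        using abs_s[of A] abs_s[of B] by linarith
      then show ?thesis
        by (auto simp: d_def K_def)
    qed
    then have "d i = 0"
      using i by (intro digits_eq_0[OF sum0]) auto
    then show ?thesis
      using i by (simp add: d_def)
  qed
  obtain k where k: "k \<in> {1..<n}" "e B k \<noteq> 0"
  proof (cases "n \<in> B")
    case True
    obtain k where "k \<in> {1..n}" "k \<notin> B"
      using B unfolding proper_subsets_def by blast
    then show ?thesis
      using True by (intro that[of k]) (auto simp: e_def le_less)
  next
    case False
    obtain k where "k \<in> {1..n}" "k \<in> B"
      using B unfolding proper_subsets_def by blast
    then show ?thesis
      using False by (intro that[of k]) (auto simp: e_def le_less)
  qed
  \<comment> \<open>The nonzero digits of \<open>B\<close> all have the same sign, decided by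
    whether \<open>n\<close> lies in \<open>B\<close>, so they cannot cancel.\<close>
  have "s B \<noteq> 0"
  proof
    assume "s B = 0"
    then have "(\<Sum>i\<in>{1..<n}. \<bar>e B i\<bar>) = 0"
    proof (cases "n \<in> B")
      case True
      then have "(\<Sum>i\<in>{1..<n}. \<bar>e B i\<bar>) = - s B"
        unfolding s_def sum_negf[symmetric] by (intro sum.cong) (auto simp: e_def)
      then show ?thesis
        using \<open>s B = 0\<close> by simp
    next
      case False
      then have "(\<Sum>i\<in>{1..<n}. \<bar>e B i\<bar>) = s B"
        unfolding s_def by (intro sum.cong) (auto simp: e_def)
      then show ?thesis
        using \<open>s B = 0\<close> by simp
    qed
    then show False
      using k by (subst (asm) sum_nonneg_eq_0_iff) auto
  qed
  have e_eq: "of_int (e A i) = r * of_int (e B i)" if "i \<in> {1..<n}" for i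
  proof -
    have "of_int (s B) * of_int (e A i) = of_int (s B) * (r * of_int (e B i))"
      using cross[OF that] eqR by (metis mult.assoc mult.commute of_int_mult)
    then show ?thesis
      using \<open>s B \<noteq> 0\<close> by simp
  qed
  have "e A k \<in> {-1, 0, 1}" "e B k \<in> {-1, 1}"
    using k(2) by (auto simp: e_def split: if_splits)
  then have "r = 1"
    using e_eq[OF k(1)] \<open>r > 0\<close> by auto
  then have e_eq: "e A i = e B i" if "i \<in> {1..<n}" for i
    using e_eq[OF that] by simp
  then have nAB: "n \<in> A \<longleftrightarrow> n \<in> B"
    using e_eq[OF k(1)] k(2) by (auto simp: e_def split: if_splits)
  have "i \<in> A \<longleftrightarrow> i \<in> B" if "i \<in> {1..n}" for i
    using that e_eq[of i] nAB by (cases "i = n") (auto simp: e_def split: if_splits)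
  then show ?thesis
    using A B by (auto simp: proper_subsets_def)
qed

text \<open>The complement has the negated plane coordinate. If this were 0, the two coordinates
  would agree and \<open>A\<close> would equal its complement.\<close>

lemma plane_coord_indic_nonzero:
  assumes "A \<in> proper_subsets n" "n \<ge> 2"
  shows "plane_coord n (indic A) \<noteq> 0"
proof
  assume 0: "plane_coord n (indic A) = 0"
  let ?B = "{1..n} - A"
  have B: "?B \<in> proper_subsets n"
    using assms(1) by (auto simp: proper_subsets_def)
  have "plane_coord n (indic ?B) = - plane_coord n (indic A)"
    unfolding plane_coord_def sum_negf[symmetric] by (intro sum.cong) (auto simp: indic_def)
  then have "A = ?B"
    using 0 by (intro plane_coord_indic_rays[OF assms(1) B, of 1]) auto
  then show False
    using assms by (auto simp: proper_subsets_def)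
qed

text \<open>Time 0 gives the symmetric point belonging to \<open>A\<close>, time 1 a point of the
  plane. Both ends of the segment have the same plane coordinate before normalisation, so the moving
  point stays over one ray.\<close>

definition moving_pt :: "nat \<Rightarrow> real \<Rightarrow> nat set \<Rightarrow> nat \<Rightarrow> real" where
  "moving_pt n t A = normalize_vec n
     (\<lambda>i. (1 - t) * center n (indic A) i + t * plane_vec n (plane_coord n (indic A)) i)"

lemma moving_pt:
  fixes t :: real
  assumes "n \<ge> 3" "A \<in> proper_subsets n"
  defines "u \<equiv> (\<lambda>i. (1 - t) * center n (indic A) i + t * plane_vec n (plane_coord n (indic A)) i)"
  shows "inner_n n u u > 0" "u \<in> hyperplane n" "plane_coord n u = plane_coord n (indic A)"
    "moving_pt n t A \<in> unit_sphere n"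
    "\<exists>r>0. plane_coord n (moving_pt n t A) = of_real r * plane_coord n (indic A)"
proof -
  show h: "u \<in> hyperplane n"
    unfolding u_def using assms(1) by (intro hyperplane_lincomb center_in_hyperplane plane_vec_in_hyperplane) auto
  show e: "plane_coord n u = plane_coord n (indic A)"
    unfolding u_def plane_coord_linear plane_coord_plane_vec[OF assms(1)] plane_coord_center by (simp add: algebra_simps)
  have "u \<in> nonconst n"
    using e plane_coord_indic_nonzero assms(1,2) by (intro nonconst_if_coords) auto
  then have "inner_n n u u \<noteq> 0"
    unfolding nonconst_def inner_n_self_eq_0 by fastforce
  then show pos: "inner_n n u u > 0"
    using inner_n_self_nonneg[of n u] by simp
  show "moving_pt n t A \<in> unit_sphere n"
    using normalize_vec_in_unit_sphere[OF h] \<open>inner_n n u u \<noteq> 0\<close> by (simp add: moving_pt_def u_def)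
  have "moving_pt n t A = (\<lambda>i. (1 / sqrt (inner_n n u u)) * u i + 0 * u i)"
    by (simp add: moving_pt_def u_def normalize_vec_def)
  then have "plane_coord n (moving_pt n t A) = of_real (1 / sqrt (inner_n n u u)) * plane_coord n (indic A)"
    using e by (simp only: plane_coord_linear) simp
  moreover have "1 / sqrt (inner_n n u u) > 0"
    using pos by simp
  ultimately show "\<exists>r>0. plane_coord n (moving_pt n t A) = of_real r * plane_coord n (indic A)"
    by blast
qed

lemma continuous_on_moving_pt:
  assumes "n \<ge> 3" "A \<in> proper_subsets n" "continuous_on S f"
  shows "continuous_on S (\<lambda>s. moving_pt n (f s) A)"
  unfolding moving_pt_def
proof (rule continuous_on_normalize_vec)
  show "continuous_on S (\<lambda>s i. (1 - f s) * center n (indic A) i + f s * plane_vec n (plane_coord n (indic A)) i)"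
    by (intro continuous_on_coordinatewise_then_product continuous_intros assms)
qed (use moving_pt(1)[OF assms(1,2)] in \<open>simp add: less_imp_neq[symmetric]\<close>)

lemma inner_n_unit_less_1:
  assumes "a \<in> unit_sphere n" "b \<in> unit_sphere n" "a \<noteq> b"
  shows "inner_n n a b < 1"
proof -
  let ?d = "\<lambda>i. a i - b i"
  obtain i where "a i \<noteq> b i"
    using assms(3) by auto
  moreover from this have "i \<in> {1..n}"
    using assms by (auto simp: unit_sphere_def hyperplane_def)
  ultimately have "inner_n n ?d ?d \<noteq> 0"
    using inner_n_self_eq_0[of n ?d] by auto
  moreover have "inner_n n ?d ?d = inner_n n a a + inner_n n b b - 2 * inner_n n a b"
    unfolding inner_n_def sum_distrib_left sum.distrib[symmetric] sum_subtractf[symmetric]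
    by (intro sum.cong) (auto simp: algebra_simps)
  ultimately show ?thesis
    using inner_n_self_nonneg[of n ?d] assms by (simp add: unit_sphere_def)
qed

text \<open>Points of different subsets stay over different rays and so never meet. Compactness of
  \<open>{0..1}\<close> and finiteness of the set of pairs make the bound uniform.\<close>

lemma moving_pt_separated:
  assumes "n \<ge> 3"
  shows "\<exists>\<delta>. 0 < \<delta> \<and> \<delta> < 1 \<and> (\<forall>t\<in>{0..1}. separated n \<delta> (proper_subsets n) (moving_pt n t))"
proof -
  let ?P = "{p \<in> proper_subsets n \<times> proper_subsets n. fst p \<noteq> snd p}"
  let ?f = "\<lambda>p t. 1 - inner_n n (moving_pt n t (fst p)) (moving_pt n t (snd p))"
  have "\<exists>m>0. \<forall>t\<in>{0..1}. m \<le> ?f p t" if p: "p \<in> ?P" for p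
  proof -
    have pos: "?f p t > 0" for t
    proof -
      let ?a = "moving_pt n t (fst p)" and ?b = "moving_pt n t (snd p)"
      obtain r s :: real where r: "r > 0" "plane_coord n ?a = of_real r * plane_coord n (indic (fst p))"
        and s: "s > 0" "plane_coord n ?b = of_real s * plane_coord n (indic (snd p))"
        using moving_pt(5)[OF assms, of "fst p" t] moving_pt(5)[OF assms, of "snd p" t] p
        unfolding mem_Collect_eq mem_Times_iff by blast
      have "?a \<noteq> ?b"
      proof
        assume "?a = ?b"
        then have "of_real r * plane_coord n (indic (fst p)) = of_real s * plane_coord n (indic (snd p))"
          using r(2) s(2) by simp
        then have "plane_coord n (indic (fst p)) = of_real (s / r) * plane_coord n (indic (snd p))"
          using r(1) by (simp add: field_simps)
        then show False
          using plane_coord_indic_rays[of "fst p" n "snd p" "s / r"] p r(1) s(1) by auto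
      qed
      then show ?thesis
        using inner_n_unit_less_1[of ?a n ?b] moving_pt(4)[OF assms] p by auto
    qed
    have "continuous_on {0..1} (?f p)"
      using p by (intro continuous_intros continuous_on_moving_pt assms) auto
    then obtain t0 where "t0 \<in> {0..1}" "\<forall>t\<in>{0..1}. ?f p t0 \<le> ?f p t"
      using continuous_attains_inf[of "{0..1::real}" "?f p"] by auto
    then show ?thesis
      using pos by blast
  qed
  then have "\<forall>p\<in>?P. \<exists>m. m > 0 \<and> (\<forall>t\<in>{0..1}. m \<le> ?f p t)"
    by blast
  from bchoice[OF this] obtain m
    where "\<forall>p\<in>?P. m p > 0 \<and> (\<forall>t\<in>{0..1}. m p \<le> ?f p t)" ..
  then have m: "\<And>p. p \<in> ?P \<Longrightarrow> m p > 0"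
    "\<And>p t. p \<in> ?P \<Longrightarrow> t \<in> {0..1} \<Longrightarrow> m p \<le> ?f p t"
    by blast+
  have fin: "finite (insert 1 (m ` ?P))"
    by simp
  \<comment> \<open>The 1 caps \<delta> at 1/4, and the division by 4 matches the factor in
    \<open>separated\<close>.\<close>
  define \<delta> where "\<delta> = Min (insert 1 (m ` ?P)) / 4"
  have "0 < Min (insert 1 (m ` ?P))"
    using m(1) fin by (subst Min_gr_iff) auto
  moreover have "Min (insert 1 (m ` ?P)) \<le> 1"
    using fin by (intro Min_le) auto
  ultimately have \<delta>: "0 < \<delta>" "\<delta> < 1"
    unfolding \<delta>_def by linarith+
  moreover have "separated n \<delta> (proper_subsets n) (moving_pt n t)" if "t \<in> {0..1}" for t
    unfolding separated_def
  proof (intro conjI ballI impI)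
    fix A B assume AB: "A \<in> proper_subsets n" "B \<in> proper_subsets n" "A \<noteq> B"
    then have "4 * \<delta> \<le> m (A, B)"
      unfolding \<delta>_def using fin by (auto intro!: Min_le)
    also have "\<dots> \<le> 1 - inner_n n (moving_pt n t A) (moving_pt n t B)"
      using m(2)[of "(A, B)" t] AB that by simp
    finally show "4 * \<delta> \<le> 1 - inner_n n (moving_pt n t A) (moving_pt n t B)" .
  qed (use moving_pt(4)[OF assms] in blast)
  ultimately show ?thesis
    by blast
qed

section \<open>Winding numbers in the plane\<close>

lemma homotopic_canonI:
  assumes "continuous_on ({0..1::real} \<times> S) h"
    and "\<And>t x. t \<in> {0..1} \<Longrightarrow> x \<in> S \<Longrightarrow> h (t, x) \<in> T"
    and "\<And>x. x \<in> S \<Longrightarrow> h (0, x) = f x" "\<And>x. x \<in> S \<Longrightarrow> h (1, x) = g x"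
  shows "homotopic_with_canon (\<lambda>_. True) S T f g"
proof -
  have "continuous_map (prod_topology (top_of_set {0..1}) (top_of_set S)) (top_of_set T) h"
    using assms(1,2) by (auto simp: subtopology_Times[symmetric] continuous_map_subtopology_eu
        simp flip: euclidean_product_topology)
  then show ?thesis
    by (subst homotopic_with) (use assms(3,4) in auto)
qed

text \<open>With \<xi> the quotient of the plane coordinates of \<open>x\<close> and of the centre,
  this is the factor by which a bump multiplies the plane coordinate of \<open>x\<close>.\<close>

definition twist_factor :: "int \<Rightarrow> real \<Rightarrow> complex \<Rightarrow> complex" where
  "twist_factor j r \<xi> = of_real (bump_id j r) + of_real (bump_pt j r) / \<xi>"

lemma twist_factor_1 [simp]: "twist_factor j 1 \<xi> = 1"
  by (simp add: twist_factor_def)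

lemma twist_factor_nonzero:
  assumes "\<xi> \<noteq> 0" and "\<And>a. a > 0 \<Longrightarrow> \<xi> = of_real a \<Longrightarrow> r = 0"
    and "\<And>a. a > 0 \<Longrightarrow> \<xi> = - of_real a \<Longrightarrow> r = 1"
  shows "twist_factor j r \<xi> \<noteq> 0"
proof
  assume "twist_factor j r \<xi> = 0"
  then have eq: "of_real (bump_id j r) * \<xi> = - of_real (bump_pt j r)"
    using assms(1) by (simp add: twist_factor_def field_simps add_eq_0_iff)
  then have L: "bump_id j r \<noteq> 0"
    using bump_nonzero[of j r] by auto
  define a where "a = - bump_pt j r / bump_id j r"
  have a: "\<xi> = of_real a"
    using eq L by (simp add: a_def field_simps)
  then have "a \<noteq> 0"
    using assms(1) by auto
  then consider "a > 0" | "- a > 0"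
    by linarith
  then show False
  proof cases
    case 1
    then have "r = 0"
      using assms(2) a by blast
    then show False
      using 1 bump_0[of j] by (simp add: a_def)
  next
    case 2
    then have "r = 1"
      using assms(3)[of "- a"] a by simp
    then show False
      using 2 by (simp add: a_def)
  qed
qed

text \<open>Half-angle forms of \<open>1 + cis (- s)\<close> and \<open>1 - cis (- s)\<close>. The
  phases are collected so that the right-hand side has a real part that is visibly nonnegative for
  \<open>s\<close> between 0 and \<open>pi\<close>.\<close>

lemma twist_factor_half_angle:
  fixes j :: int and s :: real
  defines "\<eta> \<equiv> bump_angle j (s / pi)"
  shows "twist_factor j (s / pi) (cis s) * (- cis s) powi j * cis (s / 4)
    = of_real (sqrt 2) * cis (- \<eta>) * Complex (cos \<eta> * cos (s / 2)) (sin \<eta> * sin (s / 2))"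
proof -
  have sum_cis: "cis (s / 2) + cis (- (s / 2)) = of_real (2 * cos (s / 2))"
    "cis (s / 2) - cis (- (s / 2)) = \<i> * of_real (2 * sin (s / 2))"
    by (simp_all add: complex_eq_iff)
  have plus: "1 + cis (- s) = cis (- (s / 2)) * of_real (2 * cos (s / 2))"
    unfolding sum_cis[symmetric] by (simp add: distrib_left cis_mult)
  have minus: "1 - cis (- s) = cis (- (s / 2)) * (\<i> * of_real (2 * sin (s / 2)))"
    unfolding sum_cis[symmetric] by (simp add: right_diff_distrib cis_mult)
  have regroup: "of_real (q * (c + d) / 2) + of_real (q * (c - d) / 2) * w
      = of_real (q / 2) * (of_real c * (1 + w) + of_real d * (1 - w))" for q c d :: real and w :: complex
    by (simp add: field_simps)
  have "twist_factor j (s / pi) (cis s) = of_real (sqrt 2 * (cos \<eta> + sin \<eta>) / 2)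
      + of_real (sqrt 2 * (cos \<eta> - sin \<eta>) / 2) * cis (- s)"
    by (simp only: twist_factor_def bump_id_def bump_pt_def \<eta>_def cis_inverse
        divide_inverse[of _ "cis s"])
  also have "\<dots> = of_real (sqrt 2 / 2) * (of_real (cos \<eta>) * (1 + cis (- s)) + of_real (sin \<eta>) * (1 - cis (- s)))"
    by (rule regroup)
  also have "\<dots> = of_real (sqrt 2) * cis (- (s / 2))
      * Complex (cos \<eta> * cos (s / 2)) (sin \<eta> * sin (s / 2))"
    unfolding plus minus by (simp add: Complex_eq algebra_simps)
  finally have fac: "twist_factor j (s / pi) (cis s) = \<dots>" .
  have "- cis s = cis (s - pi)"
    by (simp add: complex_eq_iff)
  then have "(- cis s) powi j = cis (of_int j * (s - pi))"
    by (simp add: cis_power_int)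
  moreover have "\<eta> = of_int j * pi - of_int j * s + s / 4"
    by (simp add: \<eta>_def bump_angle_def field_simps)
  then have "- \<eta> = - (s / 2) + of_int j * (s - pi) + s / 4"
    by (simp add: algebra_simps)
  then have "cis (- \<eta>) = cis (- (s / 2)) * cis (of_int j * (s - pi)) * cis (s / 4)"
    by (simp only: cis_mult)
  ultimately show ?thesis
    unfolding fac by (simp add: mult_ac)
qed

lemma twist_factor_cnj: "twist_factor j r (cnj \<xi>) = cnj (twist_factor j r \<xi>)"
  by (simp add: twist_factor_def)

text \<open>On the unit circle, the segment from \<open>twist_factor\<close> times \<open>(- \<xi>) powi j\<close> to 1 hence avoids 0: this
  homotopes \<open>twist_factor\<close> to a power of \<open>\<xi>\<close>.\<close>

lemma twist_factor_not_nonpos: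
  assumes "norm \<xi> = 1" "a \<ge> 0"
  shows "twist_factor j (arccos (Re \<xi>) / pi) \<xi> * (- \<xi>) powi j \<noteq> - of_real a"
proof -
  define s where "s = arccos (Re \<xi>)"
  have re: "\<bar>Re \<xi>\<bar> \<le> 1"
    using abs_Re_le_cmod[of \<xi>] assms(1) by simp
  then have s: "0 \<le> s" "s \<le> pi" "cos s = Re \<xi>"
    by (auto simp: s_def arccos_lbound arccos_ubound cos_arccos_abs)
  have "(Re \<xi>)\<^sup>2 + (Im \<xi>)\<^sup>2 = 1"
    using assms(1) by (metis cmod_power2 one_power2)
  then have "(Im \<xi>)\<^sup>2 = (sin s)\<^sup>2"
    using sin_cos_squared_add[of s] s(3) by simp
  then have "Im \<xi> = sin s \<or> Im \<xi> = - sin s"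
    by (simp add: power2_eq_iff)
  then have \<xi>: "\<xi> = cis s \<or> \<xi> = cnj (cis s)"
    using s(3) by (auto simp: complex_eq_iff)
  \<comment> \<open>The upper half circle suffices, since \<open>twist_factor\<close> and integer
    powers commute with conjugation.\<close>
  have main: "twist_factor j (s / pi) (cis s) * (- cis s) powi j \<noteq> - of_real a"
  proof
    assume eq: "twist_factor j (s / pi) (cis s) * (- cis s) powi j = - of_real a"
    define \<eta> where "\<eta> = bump_angle j (s / pi)"
    \<comment> \<open>Compares real parts in the half-angle formula: the left-hand side is
      nonpositive, as \<open>s / 4\<close> is at most \<open>pi / 4\<close>.\<close>
    have "- (a * cos (s / 4)) = Re (of_real (sqrt 2) * cis (- \<eta>)
        * Complex (cos \<eta> * cos (s / 2)) (sin \<eta> * sin (s / 2)))"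
      using arg_cong[OF twist_factor_half_angle[of j s], of Re] unfolding eq \<eta>_def[symmetric] by simp
    also have "\<dots> = sqrt 2 * ((cos \<eta>)\<^sup>2 * cos (s / 2) + (sin \<eta>)\<^sup>2 * sin (s / 2))"
      by (simp add: power2_eq_square algebra_simps)
    finally have neg: "(cos \<eta>)\<^sup>2 * cos (s / 2) + (sin \<eta>)\<^sup>2 * sin (s / 2) = - (a * cos (s / 4)) / sqrt 2"
      by simp
    have "cos (s / 4) > 0"
      using s pi_gt_zero by (intro cos_gt_zero_pi; linarith)
    then have le0: "(cos \<eta>)\<^sup>2 * cos (s / 2) + (sin \<eta>)\<^sup>2 * sin (s / 2) \<le> 0"
      using assms(2) unfolding neg by (simp add: divide_nonpos_pos)
    \<comment> \<open>At either end one of \<open>sin (s / 2)\<close> and \<open>cos (s / 2)\<close>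
      vanishes and the value of \<eta> decides: a multiple of \<open>pi\<close> at
      \<open>s = 0\<close>, and \<open>pi / 4\<close> at \<open>s = pi\<close>.\<close>
    consider "s = 0" | "s = pi" | "0 < s" "s < pi"
      using s by linarith
    then show False
    proof cases
      case 1
      then have "(cos \<eta>)\<^sup>2 = 1"
        by (simp add: \<eta>_def bump_angle_def sin_cos_int_times_pi)
      then show False
        using le0 1 by simp
    next
      case 2
      then have "(sin \<eta>)\<^sup>2 = 1 / 2"
        by (simp add: \<eta>_def bump_angle_def sin_45 power_divide)
      then show False
        using le0 2 by simp
    next
      case 3
      have p: "cos (s / 2) > 0" "sin (s / 2) > 0"
        using 3 by (auto intro!: cos_gt_zero_pi sin_gt_zero)
      have "cos \<eta> \<noteq> 0 \<or> sin \<eta> \<noteq> 0"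
        using sin_cos_squared_add[of \<eta>] by (metis add_0 power_zero_numeral zero_neq_one)
      then have "(cos \<eta>)\<^sup>2 * cos (s / 2) + (sin \<eta>)\<^sup>2 * sin (s / 2) > 0"
        using p by (auto intro: add_pos_nonneg add_nonneg_pos)
      then show False
        using le0 by simp
    qed
  qed
  show ?thesis
    using \<xi>
  proof
    assume "\<xi> = cnj (cis s)"
    moreover have "twist_factor j (s / pi) (cnj (cis s)) * (- cnj (cis s)) powi j
        = cnj (twist_factor j (s / pi) (cis s) * (- cis s) powi j)"
      by (simp only: twist_factor_cnj complex_cnj_mult complex_cnj_power_int complex_cnj_minus)
    ultimately show ?thesis
      using main unfolding s_def[symmetric]
      by (metis complex_cnj_cnj complex_cnj_complex_of_real complex_cnj_minus)
  qed (use main s_def in simp)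
qed

section \<open>The plane coordinate of a twist along the curve where the plane meets the
  sphere\<close>

lemma continuous_on_vec_of:
  fixes f :: "'a::topological_space \<Rightarrow> complex"
  assumes "continuous_on S f" "\<And>j. j \<in> {3..<n} \<Longrightarrow> continuous_on S (\<lambda>s. g s j)"
  shows "continuous_on S (\<lambda>s. vec_of n (f s) (g s))"
proof (rule continuous_on_coordinatewise_then_product)
  fix i
  show "continuous_on S (\<lambda>s. vec_of n (f s) (g s) i)"
    unfolding vec_of_def Let_def divide_inverse
    by (cases "i = 1"; cases "i = 2"; cases "i \<in> {3..<n}")
      (auto intro!: continuous_intros assms)
qed

lemma continuous_on_plane_vec:
  fixes f :: "'a::topological_space \<Rightarrow> complex"
  assumes "continuous_on S f"
  shows "continuous_on S (\<lambda>s. plane_vec n (f s))"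
  unfolding plane_vec_def by (intro continuous_on_center continuous_on_vec_of continuous_intros assms)

lemma continuous_on_plane_coord:
  fixes f :: "'a::topological_space \<Rightarrow> nat \<Rightarrow> real"
  assumes "continuous_on S f"
  shows "continuous_on S (\<lambda>s. plane_coord n (f s))"
  unfolding plane_coord_def
  by (intro continuous_intros continuous_on_product_then_coordinatewise[OF assms])

text \<open>At most one factor differs from 1, namely that of the active bump. In product form the
  bumps can be deformed independently of each other.\<close>

lemma plane_coord_twist_eq_prod:
  assumes "n \<ge> 3" "finite B" "separated n \<delta> B c" "0 < \<delta>" "x \<in> unit_sphere n"
    and z: "plane_coord n x \<noteq> 0" and c: "\<And>b. b \<in> B \<Longrightarrow> plane_coord n (c b) \<noteq> 0"
  shows "plane_coord n (twist n \<delta> B j c x)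
    = plane_coord n x * (\<Prod>b\<in>B. twist_factor (j b) (bump_radius n \<delta> x (c b)) (plane_coord n x / plane_coord n (c b)))"
  using assms(3-5)
proof (cases rule: bump_radius_eq_1_or_unique)
  case 1
  then show ?thesis
    using twist_eq(1)[OF assms(2) 1] by simp
next
  case (2 a)
  let ?f = "\<lambda>b. twist_factor (j b) (bump_radius n \<delta> x (c b)) (plane_coord n x / plane_coord n (c b))"
  have "prod ?f (B - {a}) = 1"
    using 2(3) by (intro prod.neutral) simp
  then have "prod ?f B = ?f a"
    using prod.remove[OF assms(2) 2(1), of ?f] by simp
  have eq: "twist n \<delta> B j c x = (\<lambda>i. bump_id (j a) (bump_radius n \<delta> x (c a)) * x i
      + bump_pt (j a) (bump_radius n \<delta> x (c a)) * c a i)"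
    using 2 by (intro twist_eq(2)[OF assms(2)])
  have "plane_coord n (twist n \<delta> B j c x) = plane_coord n x * ?f a"
    unfolding eq plane_coord_linear
    using z c[OF 2(1)] by (simp add: twist_factor_def field_simps)
  with \<open>prod ?f B = ?f a\<close> show ?thesis
    by simp
qed

lemma prod_power_int_eq:
  fixes u :: "'a::field"
  assumes "u \<noteq> 0"
  shows "(\<Prod>b\<in>B. u powi f b) = u powi (\<Sum>b\<in>B. f b)"
  using assms by (induction B rule: infinite_finite_induct) (simp_all add: power_int_add)

text \<open>Each bump of weight \<open>j\<close> changes the winding number along the curve by \<open>- j\<close>, so that the
  total weight 1 leaves winding number 0.\<close>

lemma log_on_curve:
  assumes n: "n \<ge> 3" and B: "finite B" "(\<Sum>b\<in>B. j b) = 1"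
    and \<delta>: "0 < \<delta>" "\<delta> < 1" and sep: "separated n \<delta> B c"
    and c: "\<And>b. b \<in> B \<Longrightarrow> c b = plane_vec n (w b)"
  defines "\<Gamma> \<equiv> {z. plane_vec n z \<in> unit_sphere n}"
  shows "\<exists>g. continuous_on \<Gamma> g \<and> (\<forall>z\<in>\<Gamma>. plane_coord n (twist n \<delta> B j c (plane_vec n z)) = exp (g z))"
proof -
  have c_in: "c b \<in> unit_sphere n" if "b \<in> B" for b
    using sep that by (auto simp: separated_def)
  have plane_vec0: "plane_vec n 0 \<notin> unit_sphere n"
    using plane_vec_scale[OF n, of 0 0] by (auto simp: unit_sphere_def inner_n_def)
  have w0: "w b \<noteq> 0" if "b \<in> B" for b
    using c_in[OF that] c[OF that] plane_vec0 by metis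
  have z0: "z \<noteq> 0" if "z \<in> \<Gamma>" for z
    using that plane_vec0 by (auto simp: \<Gamma>_def)
  have plane_coord_c: "plane_coord n (c b) = w b" if "b \<in> B" for b
    using c[OF that] by (simp add: plane_coord_plane_vec n)
  define r where "r b z = bump_radius n \<delta> (plane_vec n z) (c b)" for b z
  define \<xi> where "\<xi> b z = z / w b" for b z
  \<comment> \<open>The angle between the directions of \<open>z\<close> and \<open>w b\<close>,
    divided by \<open>pi\<close>; the first homotopy replaces the cap radius \<open>r\<close> by
    it.\<close>
  define r' where "r' b z = arccos (Re (sgn (\<xi> b z))) / pi" for b z
  have \<xi>0: "\<xi> b z \<noteq> 0" if "b \<in> B" "z \<in> \<Gamma>" for b z
    using w0 z0 that by (simp add: \<xi>_def)
  \<comment> \<open>On the ray of a centre the curve meets only the centre, on the opposite ray only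
    its antipode. There both radii are 0 and 1 respectively, hence so are their convex combinations,
    as \<open>twist_factor_nonzero\<close> demands.\<close>
  have r_pm: "(a > 0 \<longrightarrow> \<xi> b z = of_real a \<longrightarrow> r b z = 0 \<and> r' b z = 0) \<and>
      (a > 0 \<longrightarrow> \<xi> b z = - of_real a \<longrightarrow> r b z = 1 \<and> r' b z = 1)" if b: "b \<in> B" "z \<in> \<Gamma>" for a b z
  proof -
    have *: "a' = 1 \<or> a' = -1" "bump_radius n \<delta> (plane_vec n z) (c b) = min 1 ((1 - a') / \<delta>)"
      if "\<xi> b z = of_real a'" for a' :: real
    proof -
      have "z = of_real a' * w b"
        using that w0[OF b(1)] by (simp add: \<xi>_def field_simps)
      then have s: "plane_vec n z = (\<lambda>i. a' * c b i)"
        using plane_vec_scale[OF n] c[OF b(1)] by simp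
      have 1: "inner_n n (c b) (c b) = 1" "inner_n n (plane_vec n z) (plane_vec n z) = 1"
        using c_in[OF b(1)] b(2) by (auto simp: unit_sphere_def \<Gamma>_def)
      have "inner_n n (plane_vec n z) (c b) = a'"
        unfolding s using 1(1) by (subst inner_n_commute) (simp add: inner_n_scale_right)
      then show "bump_radius n \<delta> (plane_vec n z) (c b) = min 1 ((1 - a') / \<delta>)"
        by (simp add: bump_radius_def)
      have "inner_n n (plane_vec n z) (plane_vec n z) = a' * a'"
        using \<open>inner_n n (plane_vec n z) (c b) = a'\<close> by (subst (2) s) (simp add: inner_n_scale_right)
      then show "a' = 1 \<or> a' = -1"
        using 1(2) by (simp add: square_eq_1_iff)
    qed
    show ?thesis
      using *[of a] *[of "- a"] \<delta> by (auto simp: r_def r'_def min_def sgn_of_real field_simps)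
  qed
  have cont_r: "continuous_on \<Gamma> (r b)" for b
    unfolding r_def by (intro continuous_on_bump_radius continuous_on_plane_vec continuous_intros)
  have cont_\<xi>: "continuous_on \<Gamma> (\<xi> b)" if "b \<in> B" for b
    unfolding \<xi>_def using w0[OF that] by (intro continuous_intros) auto
  have cont_sgn: "continuous_on \<Gamma> (\<lambda>z. sgn (\<xi> b z))" if "b \<in> B" for b
    using that \<xi>0 by (intro continuous_intros cont_\<xi>) auto
  have re: "- 1 \<le> Re (sgn z)" "Re (sgn z) \<le> 1" for z
    using abs_Re_le_cmod[of "sgn z"] norm_sgn[of z]
    by (auto simp: abs_le_iff simp del: Re_sgn split: if_splits)
  have cont_r': "continuous_on \<Gamma> (r' b)" if "b \<in> B" for b
    unfolding r'_def
    by (intro continuous_on_divide continuous_on_arccos continuous_on_Re continuous_on_const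
        cont_sgn[OF that] ballI conjI re) simp
  \<comment> \<open>A positive divisor running from 1 to the norm, so that the quotient runs from
    \<xi> to its direction on the unit circle.\<close>
  define k where "k t b z = (1 - t) + t * norm (\<xi> b z)" for t :: real and b z
  have k_pos: "k t b z > 0" if "t \<in> {0..1}" "b \<in> B" "z \<in> \<Gamma>" for t b z
  proof (cases "t = 0")
    case False
    then have "t * norm (\<xi> b z) > 0"
      using that \<xi>0 by simp
    then show ?thesis
      using that(1) by (simp add: k_def add_nonneg_pos)
  qed (simp add: k_def)
  define h1 where "h1 = (\<lambda>(t, z). z * (\<Prod>b\<in>B. twist_factor (j b) ((1 - t) * r b z + t * r' b z)
      (\<xi> b z / of_real (k t b z))))"
  have sub: "snd ` ({0..1::real} \<times> \<Gamma>) \<subseteq> \<Gamma>"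
    by auto
  note comp_snd = continuous_on_compose2[OF _ continuous_on_snd[OF continuous_on_id] sub]
  have cont_k: "continuous_on ({0..1} \<times> \<Gamma>) (\<lambda>p. k (fst p) b (snd p))" if "b \<in> B" for b
    unfolding k_def by (intro continuous_intros comp_snd[OF cont_\<xi>[OF that]])
  have cont_h1: "continuous_on ({0..1} \<times> \<Gamma>) h1"
    unfolding h1_def case_prod_beta twist_factor_def
  proof (intro continuous_on_mult continuous_on_prod continuous_on_add continuous_on_divide
      continuous_on_of_real continuous_on_bump continuous_on_diff continuous_on_const
      continuous_on_fst continuous_on_snd continuous_on_id cont_k
      comp_snd[OF cont_r] comp_snd[OF cont_r'] comp_snd[OF cont_\<xi>] ballI)
    fix b and p :: "real \<times> complex"
    assume "b \<in> B" "p \<in> {0..1::real} \<times> \<Gamma>"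
    then have "k (fst p) b (snd p) > 0" "\<xi> b (snd p) \<noteq> 0"
      using k_pos \<xi>0 by auto
    then show "of_real (k (fst p) b (snd p)) \<noteq> (0::complex)"
      "\<xi> b (snd p) / of_real (k (fst p) b (snd p)) \<noteq> 0"
      by auto
  qed
  have nz1: "twist_factor (j b) ((1 - t) * r b z + t * r' b z) (\<xi> b z / of_real (k t b z)) \<noteq> 0"
    if tbz: "t \<in> {0..1}" "b \<in> B" "z \<in> \<Gamma>" for t b z
  proof (rule twist_factor_nonzero)
    have k: "k t b z > 0"
      using k_pos tbz by blast
    have \<xi>k: "\<xi> b z = of_real (k t b z) * (\<xi> b z / of_real (k t b z))"
      using k by simp
    show "\<xi> b z / of_real (k t b z) \<noteq> 0"
      using k \<xi>0 tbz by simp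
    show "(1 - t) * r b z + t * r' b z = 0" if "a > 0" "\<xi> b z / of_real (k t b z) = of_real a" for a
    proof -
      have "\<xi> b z = of_real (k t b z * a)"
        using \<xi>k that(2) by (metis of_real_mult)
      then show ?thesis
        using r_pm[OF tbz(2,3), of "k t b z * a"] k that(1) by simp
    qed
    show "(1 - t) * r b z + t * r' b z = 1" if "a > 0" "\<xi> b z / of_real (k t b z) = - of_real a" for a
    proof -
      have "\<xi> b z = - of_real (k t b z * a)"
        using \<xi>k that(2) by (metis of_real_mult mult_minus_right)
      then show ?thesis
        using r_pm[OF tbz(2,3), of "k t b z * a"] k that(1) by simp
    qed
  qed
  \<comment> \<open>By \<open>twist_factor_not_nonpos\<close>, the segment from \<open>Q\<close> to
    1 avoids 0 on \<Gamma>. The compensating inverse power stays outside in \<open>h2\<close> and is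
    what remains at time 1.\<close>
  define Q where "Q b z = twist_factor (j b) (r' b z) (sgn (\<xi> b z)) * (- sgn (\<xi> b z)) powi j b" for b z
  define h2 where "h2 = (\<lambda>(t, z). z * (\<Prod>b\<in>B. (of_real (1 - t) * Q b z + of_real t) *
      (- sgn (\<xi> b z)) powi (- j b)))"
  have cont_h2: "continuous_on ({0..1} \<times> \<Gamma>) h2"
    unfolding h2_def case_prod_beta Q_def twist_factor_def
    by (intro continuous_on_mult continuous_on_prod continuous_on_add continuous_on_divide
      continuous_on_of_real continuous_on_bump continuous_on_diff continuous_on_const
      continuous_on_fst continuous_on_snd continuous_on_id continuous_on_power_int[OF _ disjI2]
      continuous_on_minus comp_snd[OF cont_r'] comp_snd[OF cont_sgn] ballI)
      (use \<xi>0 in \<open>auto simp: sgn_zero_iff\<close>)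
  have nz2: "of_real (1 - t) * Q b z + of_real t \<noteq> 0" if t: "t \<in> {0..1}" "b \<in> B" "z \<in> \<Gamma>" for t b z
  proof
    assume eq: "of_real (1 - t) * Q b z + of_real t = 0"
    have "t \<noteq> 1"
      using eq by auto
    then have "Q b z = - of_real (t / (1 - t))"
      using eq by (simp add: field_simps add_eq_0_iff)
    moreover have "norm (sgn (\<xi> b z)) = 1"
      using \<xi>0 t by (simp add: norm_sgn)
    ultimately show False
      using twist_factor_not_nonpos[of "sgn (\<xi> b z)" "t / (1 - t)" "j b"] t(1)
      by (simp add: Q_def r'_def)
  qed
  have hom1: "homotopic_with_canon (\<lambda>_. True) \<Gamma> (- {0})
      (\<lambda>z. plane_coord n (twist n \<delta> B j c (plane_vec n z))) (\<lambda>z. h1 (1, z))"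
  proof (rule homotopic_canonI[OF cont_h1])
    show "h1 (t, z) \<in> - {0}" if "t \<in> {0..1}" "z \<in> \<Gamma>" for t z
      using that nz1 z0 B(1) by (simp add: h1_def)
    show "h1 (0, z) = plane_coord n (twist n \<delta> B j c (plane_vec n z))" if "z \<in> \<Gamma>" for z
      using that z0 w0 plane_coord_c n
      by (subst plane_coord_twist_eq_prod[OF n B(1) sep \<delta>(1)])
        (auto simp: h1_def k_def plane_coord_plane_vec \<Gamma>_def r_def \<xi>_def intro!: prod.cong)
  qed simp
  have hom2: "homotopic_with_canon (\<lambda>_. True) \<Gamma> (- {0}) (\<lambda>z. h1 (1, z)) (\<lambda>z. h2 (1, z))"
  proof (rule homotopic_canonI[OF cont_h2])
    show "h2 (t, z) \<in> - {0}" if "t \<in> {0..1}" "z \<in> \<Gamma>" for t z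
      using that nz2 z0 \<xi>0 B(1) by (auto simp: h2_def sgn_zero_iff)
    show "h2 (0, z) = h1 (1, z)" if "z \<in> \<Gamma>" for z
    proof -
      have "Q b z * (- sgn (\<xi> b z)) powi (- j b) = twist_factor (j b) (r' b z) (\<xi> b z / of_real (norm (\<xi> b z)))"
        if "b \<in> B" for b
        using \<xi>0[OF that \<open>z \<in> \<Gamma>\<close>]
        by (simp add: Q_def power_int_minus sgn_zero_iff sgn_eq)
      then show ?thesis
        by (simp add: h1_def h2_def k_def)
    qed
  qed simp
  define C where "C = (\<Prod>b\<in>B. (- sgn (w b)) powi j b)"
  have C0: "C \<noteq> 0"
    using w0 B(1) by (auto simp: C_def sgn_zero_iff)
  \<comment> \<open>The powers of \<open>sgn z\<close> combine to exponent -1 because the total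
    weight is 1, and \<open>z / sgn z\<close> is the positive real \<open>norm z\<close>, which has
    a continuous logarithm.\<close>
  have h2_1: "h2 (1, z) = exp (of_real (ln (norm z)) + Ln C)" if "z \<in> \<Gamma>" for z
  proof -
    have "(- sgn (\<xi> b z)) powi (- j b) = sgn z powi (- j b) * (- sgn (w b)) powi j b" for b
    proof -
      have "- sgn (\<xi> b z) = sgn z / (- sgn (w b))"
        by (simp add: \<xi>_def sgn_divide)
      then show ?thesis
        by (simp only: power_int_divide_distrib power_int_minus) (simp add: field_simps)
    qed
    then have "h2 (1, z) = z * (\<Prod>b\<in>B. sgn z powi (- j b) * (- sgn (w b)) powi j b)"
      by (simp add: h2_def)
    also have "\<dots> = z * (sgn z powi (\<Sum>b\<in>B. - j b) * C)"
      using z0[OF that] by (simp add: prod.distrib prod_power_int_eq sgn_zero_iff C_def)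
    also have "(\<Sum>b\<in>B. - j b) = - 1"
      by (simp add: sum_negf B(2))
    also have "z * (sgn z powi (- 1) * C) = of_real (norm z) * C"
      using z0[OF that] by (simp add: power_int_minus sgn_eq)
    also have "\<dots> = exp (of_real (ln (norm z)) + Ln C)"
      using z0[OF that] C0 by (simp add: exp_add exp_of_real)
    finally show ?thesis .
  qed
  have "\<exists>a. homotopic_with_canon (\<lambda>h. True) \<Gamma> (- {0}) (\<lambda>z. h2 (1, z)) (\<lambda>t. a)"
    unfolding inessential_eq_continuous_logarithm
  proof (intro exI conjI ballI)
    show "continuous_on \<Gamma> (\<lambda>z. of_real (ln (norm z)) + Ln C)"
      using z0 by (intro continuous_intros) auto
  qed (use h2_1 in auto)
  then have "\<exists>a. homotopic_with_canon (\<lambda>h. True) \<Gamma> (- {0})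
      (\<lambda>z. plane_coord n (twist n \<delta> B j c (plane_vec n z))) (\<lambda>t. a)"
    using homotopic_with_trans[OF hom1 homotopic_with_trans[OF hom2]] by blast
  then show ?thesis
    unfolding inessential_eq_continuous_logarithm .
qed

section \<open>The null-homotopy\<close>

lemma vec_of_nonconst:
  assumes "n \<ge> 3" "z \<noteq> 0 \<or> (\<exists>j\<in>{3..<n}. y j \<noteq> 0)"
  shows "vec_of n z y \<in> nonconst n"
  using assms by (intro nonconst_if_coords) (auto simp: plane_coord_vec_of vec_of_coord)

text \<open>Multiplication by \<i> on the complex numbers with real part \<open>y j\<close> and
  imaginary part \<open>y (j + 1)\<close>, for odd \<open>j\<close>.\<close>

definition rotate_pairs :: "(nat \<Rightarrow> real) \<Rightarrow> nat \<Rightarrow> real" where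
  "rotate_pairs y j = (if odd j then - y (j + 1) else y (j - 1))"

text \<open>On each pair this is multiplication by the nonzero complex number \<alpha> + \<i>
  \<beta>, hence injective. As \<open>n\<close> is odd, the indices from 3 to \<open>n - 1\<close>
  split into pairs.\<close>

lemma rotate_pairs_nonzero:
  fixes \<alpha> \<beta> :: real
  assumes "odd n" "\<alpha> \<noteq> 0 \<or> \<beta> \<noteq> 0" "\<exists>j\<in>{3..<n}. y j \<noteq> 0"
  shows "\<exists>j\<in>{3..<n}. \<alpha> * y j + \<beta> * rotate_pairs y j \<noteq> 0"
proof (rule ccontr)
  assume "\<not> ?thesis"
  then have z: "\<alpha> * y j + \<beta> * rotate_pairs y j = 0" if "j \<in> {3..<n}" for j
    using that by blast
  have pos: "\<alpha> * \<alpha> + \<beta> * \<beta> \<noteq> 0"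
    using assms(2) by (simp add: sum_squares_eq_zero_iff)
  have pair: "y j = 0 \<and> y (j + 1) = 0" if j: "j \<in> {3..<n}" "odd j" for j
  proof -
    have j1: "j + 1 \<in> {3..<n}"
      using j assms(1) by (cases "j + 1 = n") auto
    have 1: "\<alpha> * y j - \<beta> * y (j + 1) = 0" and 2: "\<alpha> * y (j + 1) + \<beta> * y j = 0"
      using z[OF j(1)] z[OF j1] j(2) by (simp_all add: rotate_pairs_def)
    have "(\<alpha> * \<alpha> + \<beta> * \<beta>) * y j = \<alpha> * (\<alpha> * y j - \<beta> * y (j + 1)) + \<beta> * (\<alpha> * y (j + 1) + \<beta> * y j)"
      "(\<alpha> * \<alpha> + \<beta> * \<beta>) * y (j + 1) = \<alpha> * (\<alpha> * y (j + 1) + \<beta> * y j) - \<beta> * (\<alpha> * y j - \<beta> * y (j + 1))"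
      by (simp_all add: algebra_simps)
    then show ?thesis
      using pos unfolding 1 2 by auto
  qed
  have "y j = 0" if j: "j \<in> {3..<n}" for j
  proof (cases "odd j")
    case False
    then have "j - 1 \<in> {3..<n}" "odd (j - 1)" "j - 1 + 1 = j"
      using j by (auto simp: le_less)
    then show ?thesis
      using pair[of "j - 1"] by simp
  qed (use pair[OF j] in blast)
  then show False
    using assms(3) by blast
qed

section \<open>Null-homotopy of a twist whose centres all lie in the plane\<close>

context
  fixes n :: nat and \<delta> :: real and B :: "nat set set" and j :: "nat set \<Rightarrow> int" and c :: "nat set \<Rightarrow> nat \<Rightarrow> real"
  assumes n: "n \<ge> 3" "odd n" and B: "finite B" "(\<Sum>b\<in>B. j b) = 1"
    and \<delta>: "0 < \<delta>" "\<delta> < 1" and sep: "separated n \<delta> B c"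
    and plane: "\<And>b. b \<in> B \<Longrightarrow> c b = plane_vec n (plane_coord n (c b))"
begin

private definition "coords x = (\<lambda>j. x j - x n :: real)" for x :: "nat \<Rightarrow> real"
private abbreviation (input) "\<psi> \<equiv> twist n \<delta> B j c"
private abbreviation (input) "coef \<equiv> twist_coeff n \<delta> B j c"

text \<open>Centres in the plane have equal coordinates from 3 to \<open>n\<close>, so their
  contributions cancel.\<close>

private lemma twist_coords:
  assumes "k \<in> {3..<n}"
  shows "\<psi> x k - \<psi> x n = coef x * coords x k"
proof -
  have "c b k = c b n" if "b \<in> B" for b
    using plane[OF that] plane_vec_coord[OF n(1) assms] by metis
  then have "(\<Sum>b\<in>B. bump_pt (j b) (bump_radius n \<delta> x (c b)) * c b k)
      = (\<Sum>b\<in>B. bump_pt (j b) (bump_radius n \<delta> x (c b)) * c b n)"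
    by (intro sum.cong) auto
  then show ?thesis
    by (simp add: twist_def coords_def algebra_simps)
qed

private lemma twist_coords_nonzero:
  assumes "x \<in> unit_sphere n"
  shows "plane_coord n (\<psi> x) \<noteq> 0 \<or> (\<exists>k\<in>{3..<n}. coef x * coords x k \<noteq> 0)"
proof (rule ccontr)
  assume *: "\<not> ?thesis"
  have h: "\<psi> x \<in> hyperplane n"
    using sep assms by (intro twist_in_hyperplane) (auto simp: separated_def unit_sphere_def)
  have eq: "\<psi> x k = \<psi> x n" if "k \<in> {3..<n}" for k
    using * twist_coords[OF that, of x] that by auto
  have "\<psi> x i = 0" for i
    using * h eq by (intro hyperplane_eq_0_if_coords[OF n(1)]) auto
  moreover have "\<psi> x \<in> nonconst n"
    using twist_nonconst[OF sep \<delta> assms B(1)] .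
  ultimately show False
    by (simp add: nonconst_def)
qed

private lemma cont_twist:
  "continuous_on (unit_sphere n) \<psi>" "continuous_on (unit_sphere n) coef"
  by (intro continuous_on_twist continuous_on_twist_coeff continuous_on_id continuous_on_const)+

private lemma cont_snd:
  fixes f :: "(nat \<Rightarrow> real) \<Rightarrow> 'x::topological_space"
  assumes "continuous_on (unit_sphere n) f"
  shows "continuous_on ({0..1::real} \<times> unit_sphere n) (\<lambda>p. f (snd p))"
  by (rule continuous_on_compose2[OF assms continuous_on_snd[OF continuous_on_id]]) auto

private lemma cont_coord: "continuous_on S (\<lambda>x::nat \<Rightarrow> real. x i)"
  by (rule continuous_on_subset[OF continuous_on_product_coordinates]) simp

private lemma cont_coords: "continuous_on S (\<lambda>x. coords x i)"
  unfolding coords_def by (intro continuous_intros cont_coord)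

text \<open>Both ends of the straight segment have the same plane coordinate and the same
  differences to the last coordinate. These are constant along the segment and do not all
  vanish.\<close>

private lemma homotopy_to_vec_of:
  "homotopic_with_canon (\<lambda>_. True) (unit_sphere n) (nonconst n)
     \<psi> (\<lambda>x. vec_of n (plane_coord n (\<psi> x)) (\<lambda>k. coef x * coords x k))"
proof (rule homotopic_canonI)
  let ?v = "\<lambda>x. vec_of n (plane_coord n (\<psi> x)) (\<lambda>k. coef x * coords x k)"
  let ?h = "\<lambda>p i. (1 - fst p) * \<psi> (snd p) i + fst p * ?v (snd p) i"
  have v: "continuous_on (unit_sphere n) ?v"
    by (intro continuous_on_vec_of continuous_on_plane_coord cont_twist continuous_on_mult cont_coords)
  show "continuous_on ({0..1} \<times> unit_sphere n) ?h"
    by (intro continuous_on_coordinatewise_then_product continuous_on_add continuous_on_mult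
        continuous_on_diff continuous_on_const continuous_on_fst continuous_on_id
        continuous_on_product_then_coordinatewise[OF cont_snd[OF v]]
        continuous_on_product_then_coordinatewise[OF cont_snd[OF cont_twist(1)]])
  show "?h (t, x) \<in> nonconst n" if x: "x \<in> unit_sphere n" for t x
  proof (rule nonconst_if_coords)
    have plane_coord: "plane_coord n (?h (t, x)) = plane_coord n (\<psi> x)"
      by (simp only: plane_coord_linear plane_coord_vec_of[OF n(1)] fst_conv snd_conv) (simp add: algebra_simps)
    have diff: "?h (t, x) k - ?h (t, x) n = coef x * coords x k" if "k \<in> {3..<n}" for k
    proof -
      have "?h (t, x) k - ?h (t, x) n = (1 - t) * (\<psi> x k - \<psi> x n) + t * (coef x * coords x k)"
        using that by (simp add: vec_of_coord[OF n(1)] algebra_simps)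
      then show ?thesis
        using twist_coords[OF that, of x] by (simp add: algebra_simps)
    qed
    show "plane_coord n (?h (t, x)) \<noteq> 0 \<or> (\<exists>k\<in>{3..<n}. ?h (t, x) k \<noteq> ?h (t, x) n)"
      using twist_coords_nonzero[OF x]
    proof
      assume "\<exists>k\<in>{3..<n}. coef x * coords x k \<noteq> 0"
      then obtain k where "k \<in> {3..<n}" "coef x * coords x k \<noteq> 0"
        by blast
      then have "?h (t, x) k \<noteq> ?h (t, x) n"
        using diff[of k] by linarith
      then show ?thesis
        using \<open>k \<in> {3..<n}\<close> by blast
    qed (simp only: plane_coord, simp)
  qed (use n in simp)
qed simp_all

text \<open>The coordinates \<open>3, \<dots>, n - 1\<close> are paired up into complex ones. Adding an imaginary part
  to the real factor of these coordinates avoids the zero when that factor is made positive.\<close>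

private lemma homotopy_untwist:
  "homotopic_with_canon (\<lambda>_. True) (unit_sphere n) (nonconst n)
     (\<lambda>x. vec_of n (plane_coord n (\<psi> x)) (\<lambda>k. coef x * coords x k))
     (\<lambda>x. vec_of n (plane_coord n (\<psi> x)) (coords x))"
proof (rule homotopic_canonI)
  let ?\<alpha> = "\<lambda>p. (1 - fst p) * coef (snd p) + fst p" and ?\<beta> = "\<lambda>p. fst p * (1 - fst p)"
  let ?h = "\<lambda>p. vec_of n (plane_coord n (\<psi> (snd p)))
      (\<lambda>k. ?\<alpha> p * coords (snd p) k + ?\<beta> p * rotate_pairs (coords (snd p)) k)"
  have r: "continuous_on (unit_sphere n) (\<lambda>x. rotate_pairs (coords x) k)" for k
    unfolding rotate_pairs_def by (cases "odd k") (auto intro!: continuous_on_minus cont_coords)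
  show "continuous_on ({0..1} \<times> unit_sphere n) ?h"
    by (intro continuous_on_vec_of continuous_on_plane_coord continuous_on_add continuous_on_mult
        continuous_on_diff continuous_on_const continuous_on_fst continuous_on_id
        cont_snd[OF cont_twist(1)] cont_snd[OF cont_twist(2)] cont_snd[OF cont_coords] cont_snd[OF r])
  show "?h (t, x) \<in> nonconst n" if t: "t \<in> {0..1}" and x: "x \<in> unit_sphere n" for t x
  proof (cases "plane_coord n (\<psi> x) \<noteq> 0")
    case False
    then have y: "\<exists>k\<in>{3..<n}. coords x k \<noteq> 0" and "coef x \<noteq> 0"
      using twist_coords_nonzero[OF x] by auto
    \<comment> \<open>The imaginary part \<open>t * (1 - t)\<close> vanishes only at the ends, where
      the real part is \<open>coef x\<close> or 1.\<close>
    have "(1 - t) * coef x + t \<noteq> 0 \<or> t * (1 - t) \<noteq> 0"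
      using \<open>coef x \<noteq> 0\<close> by (cases "t = 0"; cases "t = 1") auto
    then show ?thesis
      using rotate_pairs_nonzero[OF n(2) _ y] by (intro vec_of_nonconst[OF n(1)]) auto
  qed (auto intro: vec_of_nonconst[OF n(1)])
qed simp_all

text \<open>Where the differences vanish, the point lies on the curve \<Gamma>, and there the plane
  coordinate of the twist has a logarithm. Extended by Tietze, its exponential is nowhere zero and
  can replace the plane coordinate, since the two agree exactly where the differences give no
  protection. Then the logarithm and finally the differences are shrunk to 0.\<close>

private lemma homotopy_to_const:
  "homotopic_with_canon (\<lambda>_. True) (unit_sphere n) (nonconst n)
     (\<lambda>x. vec_of n (plane_coord n (\<psi> x)) (coords x)) (\<lambda>x. vec_of n 1 (\<lambda>_. 0))"
proof -
  define \<Gamma> where "\<Gamma> = {z. plane_vec n z \<in> unit_sphere n}"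
  obtain g where g: "continuous_on \<Gamma> g" "\<And>z. z \<in> \<Gamma> \<Longrightarrow> plane_coord n (\<psi> (plane_vec n z)) = exp (g z)"
    using log_on_curve[OF n(1) B \<delta> sep plane] unfolding \<Gamma>_def by blast
  have "\<Gamma> = {z. inner_n n (plane_vec n z) (plane_vec n z) = 1}"
    by (auto simp: \<Gamma>_def unit_sphere_def plane_vec_in_hyperplane n)
  moreover have "continuous_on UNIV (\<lambda>z. inner_n n (plane_vec n z) (plane_vec n z))"
    by (intro continuous_on_inner_n continuous_on_plane_vec continuous_on_id)
  ultimately have "closed \<Gamma>"
    by (simp add: closed_Collect_eq)
  then obtain G where G: "continuous_on UNIV G" "\<And>z. z \<in> \<Gamma> \<Longrightarrow> G z = g z"
    using Tietze_unbounded[of \<Gamma> g UNIV] g(1) by auto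
  have on_plane: "plane_coord n (\<psi> x) = exp (G (plane_coord n x))"
    if x: "x \<in> unit_sphere n" and y: "\<not> (\<exists>k\<in>{3..<n}. coords x k \<noteq> 0)" for x
  proof -
    have "x = plane_vec n (plane_coord n x)"
      using x y by (intro eq_plane_vec n) (auto simp: coords_def unit_sphere_def)
    then show ?thesis
      using x g(2)[of "plane_coord n x"] G(2)[of "plane_coord n x"] by (auto simp: \<Gamma>_def)
  qed
  have cont_plane_coord: "continuous_on (unit_sphere n) (plane_coord n)"
    by (intro continuous_on_plane_coord continuous_on_id)
  have cont_G: "continuous_on (unit_sphere n) (\<lambda>x. G (plane_coord n x))"
    by (intro continuous_on_compose2[OF G(1) cont_plane_coord]) simp
  have h1: "homotopic_with_canon (\<lambda>_. True) (unit_sphere n) (nonconst n)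
     (\<lambda>x. vec_of n (plane_coord n (\<psi> x)) (coords x)) (\<lambda>x. vec_of n (exp (G (plane_coord n x))) (coords x))"
  proof (rule homotopic_canonI)
    let ?h = "\<lambda>p. vec_of n (of_real (1 - fst p) * plane_coord n (\<psi> (snd p))
        + of_real (fst p) * exp (G (plane_coord n (snd p)))) (coords (snd p))"
    show "continuous_on ({0..1} \<times> unit_sphere n) ?h"
      by (intro continuous_on_vec_of continuous_on_add continuous_on_mult continuous_on_of_real
          continuous_on_diff continuous_on_const continuous_on_fst continuous_on_id continuous_on_exp
          continuous_on_plane_coord cont_snd[OF cont_twist(1)] cont_snd[OF cont_G] cont_snd[OF cont_coords])
    show "?h (t, x) \<in> nonconst n" if x: "x \<in> unit_sphere n" for t x
    proof (cases "\<exists>k\<in>{3..<n}. coords x k \<noteq> 0")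
      case False
      have "of_real (1 - t) * plane_coord n (\<psi> x) + of_real t * exp (G (plane_coord n x)) = exp (G (plane_coord n x))"
        using on_plane[OF x False] by (simp add: algebra_simps)
      then show ?thesis
        by (intro vec_of_nonconst[OF n(1)]) simp
    qed (auto intro: vec_of_nonconst[OF n(1)])
  qed simp_all
  have h2: "homotopic_with_canon (\<lambda>_. True) (unit_sphere n) (nonconst n)
     (\<lambda>x. vec_of n (exp (G (plane_coord n x))) (coords x)) (\<lambda>x. vec_of n 1 (coords x))"
  proof (rule homotopic_canonI)
    let ?h = "\<lambda>p. vec_of n (exp (of_real (1 - fst p) * G (plane_coord n (snd p)))) (coords (snd p))"
    show "continuous_on ({0..1} \<times> unit_sphere n) ?h"
      by (intro continuous_on_vec_of continuous_on_mult continuous_on_of_real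
          continuous_on_diff continuous_on_const continuous_on_fst continuous_on_id continuous_on_exp
          cont_snd[OF cont_G] cont_snd[OF cont_coords])
  qed (auto intro!: vec_of_nonconst[OF n(1)])
  have h3: "homotopic_with_canon (\<lambda>_. True) (unit_sphere n) (nonconst n)
     (\<lambda>x. vec_of n 1 (coords x)) (\<lambda>x. vec_of n 1 (\<lambda>_. 0))"
  proof (rule homotopic_canonI)
    let ?h = "\<lambda>p. vec_of n 1 (\<lambda>k. (1 - fst p) * coords (snd p) k)"
    show "continuous_on ({0..1} \<times> unit_sphere n) ?h"
      by (intro continuous_on_vec_of continuous_on_mult continuous_on_diff continuous_on_const
          continuous_on_fst continuous_on_id cont_snd[OF cont_coords])
  qed (auto intro!: vec_of_nonconst[OF n(1)])
  show ?thesis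
    by (rule homotopic_with_trans[OF h1 homotopic_with_trans[OF h2 h3]])
qed

lemma twist_nullhomotopic:
  "homotopic_with_canon (\<lambda>_. True) (unit_sphere n) (nonconst n)
     (twist n \<delta> B j c) (\<lambda>x. vec_of n 1 (\<lambda>_. 0))"
  by (rule homotopic_with_trans[OF homotopy_to_vec_of
        homotopic_with_trans[OF homotopy_untwist homotopy_to_const]])

end

section \<open>Construction of the equivariant map\<close>

lemma homotopic_canonE:
  assumes "homotopic_with_canon (\<lambda>_. True) S T f g"
  obtains h where "continuous_on ({0..1::real} \<times> S) h"
    "\<And>t x. t \<in> {0..1} \<Longrightarrow> x \<in> S \<Longrightarrow> h (t, x) \<in> T"
    "\<And>x. x \<in> S \<Longrightarrow> h (0, x) = f x" "\<And>x. x \<in> S \<Longrightarrow> h (1, x) = g x"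
proof -
  obtain h where h: "continuous_map (prod_topology (top_of_set {0..1::real}) (top_of_set S)) (top_of_set T) h"
    "\<forall>x\<in>topspace (top_of_set S). h (0, x) = f x" "\<forall>x\<in>topspace (top_of_set S). h (1, x) = g x"
    using assms by (subst (asm) homotopic_with) auto
  have "prod_topology (top_of_set {0..1::real}) (top_of_set S) = top_of_set ({0..1} \<times> S)"
    by (simp add: subtopology_Times)
  then have "continuous_on ({0..1} \<times> S) h" "h \<in> {0..1} \<times> S \<rightarrow> T"
    using h(1) by (simp_all add: continuous_map_subtopology_eu)
  then show ?thesis
    using h(2,3) by (intro that[of h]) auto
qed

section \<open>Extension of a null-homotopic map from the sphere to all vectors\<close>

lemma center_id: "x \<in> hyperplane n \<Longrightarrow> center n x = x"
  by (auto simp: hyperplane_def center_def mean_def)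

lemma retract_sphere_id: "x \<in> unit_sphere n \<Longrightarrow> retract_sphere n x = x"
  by (simp add: unit_sphere_def retract_sphere_def normalize_vec_def center_id)

text \<open>The squared norm \<open>q\<close> of the centred vector determines the time of the
  homotopy: 0 for \<open>q \<ge> 1\<close>, rising to 1 as \<open>q\<close> falls to 1/2. Closer to
  the diagonal, where the retraction breaks down, the value is the constant
  \<open>k\<close>.\<close>

lemma extend_nullhomotopic:
  assumes "homotopic_with_canon (\<lambda>_. True) (unit_sphere n) T f (\<lambda>_. k)" "k \<in> T"
  obtains \<Phi> where "continuous_on UNIV \<Phi>" "range \<Phi> \<subseteq> T" "\<And>x. x \<in> unit_sphere n \<Longrightarrow> \<Phi> x = f x"
proof -
  obtain h where h: "continuous_on ({0..1::real} \<times> unit_sphere n) h"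
    "\<And>t x. t \<in> {0..1} \<Longrightarrow> x \<in> unit_sphere n \<Longrightarrow> h (t, x) \<in> T"
    "\<And>x. x \<in> unit_sphere n \<Longrightarrow> h (0, x) = f x" "\<And>x. x \<in> unit_sphere n \<Longrightarrow> h (1, x) = k"
    using homotopic_canonE[OF assms(1)] by blast
  define q where "q x = inner_n n (center n x) (center n x)" for x
  define \<tau> where "\<tau> x = max 0 (min 1 (2 - 2 * q x))" for x
  define \<Phi> where "\<Phi> x = (if q x \<le> 1 / 2 then k else h (\<tau> x, retract_sphere n x))" for x
  have nonconst: "x \<in> nonconst n" if q0: "q x \<noteq> 0" for x
  proof -
    obtain l where l: "l \<in> {1..n}" "center n x l \<noteq> 0"
      using q0 unfolding q_def inner_n_self_eq_0 by blast
    then have "center n x \<in> hyperplane n"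
      by (intro center_in_hyperplane) auto
    then have "center n x \<in> nonconst n"
      using hyperplane_const_imp_0 l(2) by blast
    then obtain i k where "i \<in> {1..n}" "k \<in> {1..n}" "center n x i \<noteq> center n x k"
      unfolding nonconst_def by blast
    then have "x i \<noteq> x k"
      unfolding center_def by auto
    with \<open>i \<in> {1..n}\<close> \<open>k \<in> {1..n}\<close> show ?thesis
      unfolding nonconst_def by blast
  qed
  have \<tau>: "\<tau> x \<in> {0..1}" for x
    by (simp add: \<tau>_def)
  have cont_q: "continuous_on S q" for S
    unfolding q_def by (intro continuous_on_inner_n continuous_on_center continuous_on_id)
  have "continuous_on UNIV \<Phi>"
    unfolding \<Phi>_def
  proof (rule continuous_on_cases_le)
    have sub: "{x \<in> UNIV. 1 / 2 \<le> q x} \<subseteq> nonconst n"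
      using nonconst by auto
    have "continuous_on {x \<in> UNIV. 1 / 2 \<le> q x} (\<lambda>x. (\<tau> x, retract_sphere n x))"
      unfolding \<tau>_def
      by (intro continuous_on_Pair continuous_on_max continuous_on_min continuous_on_diff
          continuous_on_mult continuous_on_const cont_q
          continuous_on_subset[OF continuous_on_retract_sphere sub])
    then show "continuous_on {x \<in> UNIV. 1 / 2 \<le> q x} (\<lambda>x. h (\<tau> x, retract_sphere n x))"
      by (rule continuous_on_compose2[OF h(1)]) (use \<tau> sub retract_sphere_in in auto)
    show "k = h (\<tau> x, retract_sphere n x)" if "q x = 1 / 2" for x
      using that h(4)[OF retract_sphere_in[OF nonconst]] by (simp add: \<tau>_def)
  qed (use cont_q in auto)
  moreover have "\<Phi> x \<in> T" for x
    using assms(2) h(2)[OF \<tau> retract_sphere_in[OF nonconst]] by (auto simp: \<Phi>_def)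
  moreover have "\<Phi> x = f x" if "x \<in> unit_sphere n" for x
  proof -
    have "q x = 1"
      using that by (simp add: q_def unit_sphere_def center_id)
    then show ?thesis
      using that h(3) by (simp add: \<Phi>_def \<tau>_def retract_sphere_id)
  qed
  ultimately show ?thesis
    using that by blast
qed

section \<open>Symmetry of the twist at the indicator points\<close>

lemma moving_pt_0: "moving_pt n 0 A = normalize_vec n (center n (indic A))"
  by (simp add: moving_pt_def)

lemma moving_pt_1:
  assumes "n \<ge> 3" "A \<in> proper_subsets n"
  shows "moving_pt n 1 A = plane_vec n (plane_coord n (moving_pt n 1 A))"
proof (rule eq_plane_vec[OF assms(1)])
  show "moving_pt n 1 A \<in> hyperplane n"
    using moving_pt(4)[OF assms] by (simp add: unit_sphere_def)
  show "moving_pt n 1 A k = moving_pt n 1 A n" if "k \<in> {3..<n}" for k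
    using plane_vec_coord[OF assms(1) that] by (simp add: moving_pt_def normalize_vec_def)
qed

lemma moving_pt_0_permute:
  assumes "p permutes {1..n}"
  shows "moving_pt n 0 (p ` A) = moving_pt n 0 A \<circ> inv' p"
proof -
  have "indic (p ` A) = indic A \<circ> inv' p"
  proof
    fix i
    have "i \<in> p ` A \<longleftrightarrow> inv' p i \<in> A"
      using assms by (metis bij_image_Collect_eq permutes_bij mem_Collect_eq Collect_mem_eq)
    then show "indic (p ` A) i = (indic A \<circ> inv' p) i"
      by (simp add: indic_def)
  qed
  then show ?thesis
    by (simp only: moving_pt_0 center_permute[OF permutes_inv[OF assms]]
        normalize_vec_permute[OF permutes_inv[OF assms]])
qed

text \<open>Replacing \<open>A\<close> by its image under \<open>p\<close> permutes the coordinates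
  of the centres and keeps the weights, which depend only on \<open>card A\<close>; it merely
  reindexes the sums.\<close>

lemma twist_permute:
  fixes \<delta> :: real and J :: "nat \<Rightarrow> int"
  assumes p: "p permutes {1..n}"
  defines "T \<equiv> twist n \<delta> (proper_subsets n) (\<lambda>A. J (card A)) (moving_pt n 0)"
  shows "T (x \<circ> inv' p) = T x \<circ> inv' p"
proof -
  have bij: "bij_betw ((`) p) (proper_subsets n) (proper_subsets n)"
  proof (rule bij_betw_byWitness[where f' = "(`) (inv' p)"])
    have im: "p ` {1..n} = {1..n}" "inv' p ` {1..n} = {1..n}"
      using p by (auto simp: permutes_image permutes_inv)
    have cancel: "inv' p ` p ` A = A" "p ` inv' p ` A = A" for A
      using permutes_inv_o[OF p] by (simp_all add: image_comp)
    have "p ` A \<in> proper_subsets n" if A: "A \<in> proper_subsets n" for A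
    proof -
      have "p ` A \<subseteq> {1..n}"
        using A im(1) unfolding proper_subsets_def by blast
      moreover have "p ` A \<noteq> {1..n}"
        using A im(2) cancel(1)[of A] unfolding proper_subsets_def by auto
      ultimately show ?thesis
        using A by (simp add: proper_subsets_def)
    qed
    then show "(`) p ` proper_subsets n \<subseteq> proper_subsets n"
      by blast
    have "inv' p ` A \<in> proper_subsets n" if A: "A \<in> proper_subsets n" for A
    proof -
      have "inv' p ` A \<subseteq> {1..n}"
        using A im(2) unfolding proper_subsets_def by blast
      moreover have "inv' p ` A \<noteq> {1..n}"
        using A im(1) cancel(2)[of A] unfolding proper_subsets_def by auto
      ultimately show ?thesis
        using A by (simp add: proper_subsets_def)
    qed
    then show "(`) (inv' p) ` proper_subsets n \<subseteq> proper_subsets n"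
      by blast
    show "\<forall>A\<in>proper_subsets n. inv' p ` p ` A = A" "\<forall>A\<in>proper_subsets n. p ` inv' p ` A = A"
      using cancel by auto
  qed
  have cl: "bump_radius n \<delta> (x \<circ> inv' p) (moving_pt n 0 (p ` A)) = bump_radius n \<delta> x (moving_pt n 0 A)" for A
    by (simp only: bump_radius_def moving_pt_0_permute[OF p] inner_n_permute[OF permutes_inv[OF p]])
  have mp: "moving_pt n 0 (p ` A) i = moving_pt n 0 A (inv' p i)" for A i
    by (simp only: moving_pt_0_permute[OF p] comp_def)
  have card: "card (p ` A) = card A" for A
    by (rule card_image) (use permutes_inj[OF p] in \<open>auto intro: inj_on_subset\<close>)
  have "twist_coeff n \<delta> (proper_subsets n) (\<lambda>A. J (card A)) (moving_pt n 0) (x \<circ> inv' p)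
      = twist_coeff n \<delta> (proper_subsets n) (\<lambda>A. J (card A)) (moving_pt n 0) x"
    unfolding twist_coeff_def by (subst sum.reindex_bij_betw[OF bij, symmetric]) (simp add: cl card)
  moreover have "(\<Sum>A\<in>proper_subsets n. bump_pt (J (card A)) (bump_radius n \<delta> (x \<circ> inv' p) (moving_pt n 0 A))
        * moving_pt n 0 A i)
      = (\<Sum>A\<in>proper_subsets n. bump_pt (J (card A)) (bump_radius n \<delta> x (moving_pt n 0 A))
        * moving_pt n 0 A (inv' p i))" for i
    by (subst sum.reindex_bij_betw[OF bij, symmetric]) (simp only: cl card mp)
  ultimately show ?thesis
    by (simp add: T_def twist_def fun_eq_iff)
qed

text \<open>The twist at time 0 is equivariant. Moving the centres to time 1 destroys the symmetry
  but is a homotopy through nonconstant vectors to a null-homotopic map. The extension \<Phi>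
  inherits equivariance on the sphere from time 0.\<close>

proposition ex_equivariant_nullhomotopic:
  assumes "n \<ge> 3" "odd n" "\<not> primepow n"
  shows "\<exists>\<Phi>. continuous_on UNIV \<Phi> \<and> range \<Phi> \<subseteq> nonconst n \<and>
    (\<forall>p x. p permutes {1..n} \<longrightarrow> x \<in> unit_sphere n \<longrightarrow> \<Phi> (x \<circ> inv' p) = \<Phi> x \<circ> inv' p)"
proof -
  let ?P = "proper_subsets n"
  obtain J :: "nat \<Rightarrow> int" where "(\<Sum>k\<in>{1..<n}. J k * int (n choose k)) = 1"
    using ex_binomial_combination_1[of n] assms by auto
  then have J: "(\<Sum>A\<in>?P. J (card A)) = 1"
    by (simp add: sum_proper_subsets_card)
  let ?j = "\<lambda>A. J (card A)"
  obtain \<delta> where \<delta>: "0 < \<delta>" "\<delta> < 1"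
    and sep: "\<And>t. t \<in> {0..1} \<Longrightarrow> separated n \<delta> ?P (moving_pt n t)"
    using moving_pt_separated[OF assms(1)] by blast
  have "homotopic_with_canon (\<lambda>_. True) (unit_sphere n) (nonconst n)
      (twist n \<delta> ?P ?j (moving_pt n 0)) (twist n \<delta> ?P ?j (moving_pt n 1))"
  proof (rule homotopic_canonI)
    let ?h = "\<lambda>p. twist n \<delta> ?P ?j (moving_pt n (fst p)) (snd p)"
    show "continuous_on ({0..1} \<times> unit_sphere n) ?h"
      by (intro continuous_on_twist continuous_on_moving_pt assms continuous_on_fst
          continuous_on_snd continuous_on_id)
    show "?h (t, x) \<in> nonconst n" if "t \<in> {0..1}" "x \<in> unit_sphere n" for t x
      using twist_nonconst[OF sep[OF that(1)] \<delta> that(2)] by simp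
  qed simp_all
  moreover have "homotopic_with_canon (\<lambda>_. True) (unit_sphere n) (nonconst n)
      (twist n \<delta> ?P ?j (moving_pt n 1)) (\<lambda>_. vec_of n 1 (\<lambda>_. 0))"
    using assms \<delta> J sep[of 1] moving_pt_1 by (intro twist_nullhomotopic) auto
  ultimately have "homotopic_with_canon (\<lambda>_. True) (unit_sphere n) (nonconst n)
      (twist n \<delta> ?P ?j (moving_pt n 0)) (\<lambda>_. vec_of n 1 (\<lambda>_. 0))"
    by (rule homotopic_with_trans)
  moreover have "vec_of n 1 (\<lambda>_. 0) \<in> nonconst n"
    using vec_of_nonconst[OF assms(1)] by simp
  ultimately obtain \<Phi> where \<Phi>: "continuous_on UNIV \<Phi>" "range \<Phi> \<subseteq> nonconst n"
    and eq: "\<And>x. x \<in> unit_sphere n \<Longrightarrow> \<Phi> x = twist n \<delta> ?P ?j (moving_pt n 0) x"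
    using extend_nullhomotopic by blast
  have "\<Phi> (x \<circ> inv' p) = \<Phi> x \<circ> inv' p" if "p permutes {1..n}" "x \<in> unit_sphere n" for p x
    using that eq unit_sphere_permute twist_permute[OF that(1)] by simp
  then show ?thesis
    using \<Phi> by blast
qed

text \<open>For each \<open>g\<close>, separate \<open>x\<close> from \<open>act g x\<close> and cut
  the neighbourhood of \<open>x\<close> down to the preimage of the other one. Intersect over the
  finite set \<open>G\<close> and shrink to a closed neighbourhood by regularity.\<close>

lemma ex_disjoint_nbhd:
  assumes X: "compact_space X" "Hausdorff_space X" and x: "x \<in> topspace X"
    and fin: "finite G" and act: "\<And>g. g \<in> G \<Longrightarrow> continuous_map X X (act g)"
    and moves: "\<And>g. g \<in> G \<Longrightarrow> act g x \<noteq> x"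
  obtains U K where "openin X U" "x \<in> U" "U \<subseteq> K" "closedin X K" "\<And>g. g \<in> G \<Longrightarrow> act g ` K \<inter> K = {}"
proof -
  have "\<exists>V. openin X V \<and> x \<in> V \<and> act g ` V \<inter> V = {}" if g: "g \<in> G" for g
  proof -
    have "act g x \<in> topspace X"
      using act[OF g] x continuous_map_image_subset_topspace by fastforce
    then obtain V W where VW: "openin X V" "openin X W" "act g x \<in> V" "x \<in> W" "disjnt V W"
      using X(2) x moves[OF g] unfolding Hausdorff_space_def by metis
    let ?V = "W \<inter> {y \<in> topspace X. act g y \<in> V}"
    have "openin X ?V"
      using VW act[OF g] by (intro openin_Int openin_continuous_map_preimage)
    moreover have "act g ` ?V \<inter> ?V = {}"
      using VW(5) by (auto simp: disjnt_iff)
    ultimately show ?thesis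
      using VW x by blast
  qed
  then have "\<forall>g\<in>G. \<exists>V. openin X V \<and> x \<in> V \<and> act g ` V \<inter> V = {}"
    by blast
  from bchoice[OF this] obtain V where V: "\<forall>g\<in>G. openin X (V g) \<and> x \<in> V g \<and> act g ` V g \<inter> V g = {}" ..
  \<comment> \<open>The factor \<open>topspace X\<close> makes \<open>?W\<close> open also when
    \<open>G\<close> is empty.\<close>
  let ?W = "topspace X \<inter> \<Inter> (V ` G)"
  have "openin X ?W"
    using V fin by (cases "G = {}") (auto intro!: openin_Int openin_Inter)
  moreover have "x \<in> ?W"
    using V x by blast
  moreover have "regular_space X"
    using X compact_Hausdorff_imp_regular_space by blast
  ultimately obtain U K where "openin X U" "closedin X K" "x \<in> U" "U \<subseteq> K" "K \<subseteq> ?W"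
    unfolding neighbourhood_base_of_closedin[symmetric] neighbourhood_base_of by metis
  moreover have "act g ` K \<inter> K = {}" if "g \<in> G" for g
    using V that \<open>K \<subseteq> ?W\<close> by blast
  ultimately show ?thesis
    using that by blast
qed

text \<open>By freeness each point has a closed neighbourhood disjoint from its nontrivial
  translates. Finitely many of these cover \<open>X\<close>, and their translates are added one
  neighbourhood at a time.\<close>

lemma ex_equivariant_map_to_sphere:
  fixes X :: "'a topology" and act :: "(nat \<Rightarrow> nat) \<Rightarrow> 'a \<Rightarrow> 'a"
  assumes n: "n \<ge> 3" "odd n" "\<not> primepow n"
    and X: "compact_space X" "Hausdorff_space X"
    and act: "\<And>p. p permutes {1..n} \<Longrightarrow> continuous_map X X (act p)"
    and act_id: "\<And>x. x \<in> topspace X \<Longrightarrow> act id x = x"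
    and act_comp: "\<And>p q x. \<lbrakk>p permutes {1..n}; q permutes {1..n}; x \<in> topspace X\<rbrakk>
      \<Longrightarrow> act (p \<circ> q) x = act p (act q x)"
    and free: "\<And>p x. \<lbrakk>p permutes {1..n}; x \<in> topspace X; act p x = x\<rbrakk> \<Longrightarrow> p = id"
  shows "\<exists>f. continuous_map X euclidean f \<and> f ` topspace X \<subseteq> unit_sphere n \<and>
    (\<forall>p x. p permutes {1..n} \<longrightarrow> x \<in> topspace X \<longrightarrow> f (act p x) = f x \<circ> inv' p)"
proof -
  let ?G = "{p. p permutes {1..n}}"
  obtain \<Phi> where \<Phi>: "continuous_on UNIV \<Phi>" "range \<Phi> \<subseteq> nonconst n"
    "\<And>p x. \<lbrakk>p permutes {1..n}; x \<in> unit_sphere n\<rbrakk> \<Longrightarrow> \<Phi> (x \<circ> inv' p) = \<Phi> x \<circ> inv' p"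
    using ex_equivariant_nullhomotopic[OF n] by blast
  define small where "small K \<longleftrightarrow> closedin X K \<and> (\<forall>p. p permutes {1..n} \<longrightarrow> p \<noteq> id \<longrightarrow> act p ` K \<inter> K = {})" for K
  have "\<exists>U. openin X U \<and> x \<in> U \<and> (\<exists>K. U \<subseteq> K \<and> small K)" if x: "x \<in> topspace X" for x
  proof -
    have "finite (?G - {id})"
      by (simp add: finite_permutations)
    moreover have "act g x \<noteq> x" if "g \<in> ?G - {id}" for g
      using free[of g x] that x by auto
    ultimately obtain U K where "openin X U" "x \<in> U" "U \<subseteq> K" "closedin X K"
      "\<And>g. g \<in> ?G - {id} \<Longrightarrow> act g ` K \<inter> K = {}"
      using ex_disjoint_nbhd[OF X x, of "?G - {id}" act] act by auto
    then show ?thesis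
      unfolding small_def by (intro exI[of _ U] conjI exI[of _ K]) auto
  qed
  then have "\<forall>x\<in>topspace X. \<exists>U. openin X U \<and> x \<in> U \<and> (\<exists>K. U \<subseteq> K \<and> small K)"
    by (intro ballI)
  from bchoice[OF this] obtain U
    where U: "\<forall>x\<in>topspace X. openin X (U x) \<and> x \<in> U x \<and> (\<exists>K. U x \<subseteq> K \<and> small K)" ..
  then have "(\<forall>V\<in>U ` topspace X. openin X V) \<and> topspace X \<subseteq> \<Union> (U ` topspace X)"
    by blast
  then obtain \<U> where \<U>: "finite \<U>" "\<U> \<subseteq> U ` topspace X" "topspace X \<subseteq> \<Union> \<U>"
    using X(1) unfolding compact_space_alt by meson
  then have "\<forall>V\<in>\<U>. \<exists>K. V \<subseteq> K \<and> small K"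
    using U by blast
  from bchoice[OF this] obtain K where K: "\<forall>V\<in>\<U>. V \<subseteq> K V \<and> small (K V)" ..
  \<comment> \<open>The map changes at every stage, so the induction claims only that some
    equivariant map exists on a closed invariant set containing the neighbourhoods treated so
    far.\<close>
  have step: "\<exists>Z f. \<Union> (K ` \<V>) \<subseteq> Z \<and> closedin X Z \<and> (\<forall>p. p permutes {1..n} \<longrightarrow> act p ` Z \<subseteq> Z) \<and>
      continuous_map (subtopology X Z) euclidean f \<and> f ` Z \<subseteq> unit_sphere n \<and>
      (\<forall>p x. p permutes {1..n} \<longrightarrow> x \<in> Z \<longrightarrow> f (act p x) = f x \<circ> inv' p)"
    if "finite \<V>" "\<V> \<subseteq> \<U>" for \<V>
    using that
  proof (induction \<V> rule: finite_induct)
    case empty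
    show ?case
      by (intro exI[of _ "{}"] exI[of _ "\<lambda>_ _. 0"]) (simp add: continuous_map_def)
  next
    case (insert V \<V>)
    then have "\<V> \<subseteq> \<U>"
      by simp
    from insert.IH[OF this] obtain Z and f :: "'a \<Rightarrow> nat \<Rightarrow> real" where Z: "\<Union> (K ` \<V>) \<subseteq> Z" "closedin X Z"
      "\<forall>p. p permutes {1..n} \<longrightarrow> act p ` Z \<subseteq> Z"
      and f: "continuous_map (subtopology X Z) euclidean f" "f ` Z \<subseteq> unit_sphere n"
      "\<forall>p x. p permutes {1..n} \<longrightarrow> x \<in> Z \<longrightarrow> f (act p x) = f x \<circ> inv' p"
      by (elim exE conjE) (rule that)
    have KV: "closedin X (K V)" "\<And>p. \<lbrakk>p permutes {1..n}; p \<noteq> id\<rbrakk> \<Longrightarrow> act p ` K V \<inter> K V = {}"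
      using K insert.prems by (auto simp: small_def)
    let ?Z = "Z \<union> (\<Union>p\<in>?G. act p ` K V)"
    have ext1: "closedin X ?Z"
      by (rule extend_over_translates(1)[OF X act act_id act_comp KV Z(2) Z(3)[rule_format]
          f(1,2) f(3)[rule_format] \<Phi>])
    have ext2: "act p ` ?Z \<subseteq> ?Z" if "p permutes {1..n}" for p
      by (rule extend_over_translates(2)[OF X act act_id act_comp KV Z(2) Z(3)[rule_format]
          f(1,2) f(3)[rule_format] \<Phi>]) (assumption | rule that)+
    have ext3: "\<exists>f'. continuous_map (subtopology X ?Z) euclidean f' \<and> f' ` ?Z \<subseteq> unit_sphere n \<and>
        (\<forall>p x. p permutes {1..n} \<longrightarrow> x \<in> ?Z \<longrightarrow> f' (act p x) = f' x \<circ> inv' p)"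
      by (rule extend_over_translates(3)[OF X act act_id act_comp KV Z(2) Z(3)[rule_format]
          f(1,2) f(3)[rule_format] \<Phi>])
    have "K V \<subseteq> act id ` K V"
      using KV(1) act_id closedin_subset by force
    moreover have "id permutes {1..n}"
      by (rule permutes_id)
    ultimately have "K V \<subseteq> ?Z"
      by blast
    then have "\<Union> (K ` insert V \<V>) \<subseteq> ?Z"
      using Z(1) by auto
    moreover have "\<forall>p. p permutes {1..n} \<longrightarrow> act p ` ?Z \<subseteq> ?Z"
      by (intro allI impI ext2)
    moreover from ext3 obtain f' where "continuous_map (subtopology X ?Z) euclidean f'"
      "f' ` ?Z \<subseteq> unit_sphere n"
      "\<forall>p x. p permutes {1..n} \<longrightarrow> x \<in> ?Z \<longrightarrow> f' (act p x) = f' x \<circ> inv' p"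
      by (elim exE conjE) (rule that)
    ultimately show ?case
      using ext1 by (intro exI[of _ ?Z] exI[of _ f'] conjI)
  qed
  obtain Z f where Z: "\<Union> (K ` \<U>) \<subseteq> Z" "closedin X Z"
    and f: "continuous_map (subtopology X Z) euclidean f" "f ` Z \<subseteq> unit_sphere n"
      "\<forall>p x. p permutes {1..n} \<longrightarrow> x \<in> Z \<longrightarrow> f (act p x) = f x \<circ> inv' p"
    using step[OF \<U>(1) subset_refl] by (elim exE conjE) (rule that)
  have "topspace X \<subseteq> \<Union> (K ` \<U>)"
    using \<U>(3) K by blast
  then have "Z = topspace X"
    using Z(1) closedin_subset[OF Z(2)] by (meson subset_antisym subset_trans)
  then show ?thesis
    using f by (intro exI[of _ f]) (simp only: subtopology_topspace)
qed

theorem theorem5p1: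
  fixes n :: nat
  assumes "n \<ge> 2" and "odd n" and "\<not> primepow n"
  shows "\<forall>(X :: 'a topology) \<phi>.
    compact_space X \<and> Hausdorff_space X \<and>
    continuous_group_action (sym_group n) X \<phi> \<and>
    free_group_action (sym_group n) (topspace X) \<phi> \<longrightarrow>
    (\<exists>f. continuous_map X (real_space n) f \<and>
         equivariant_map (sym_group n) (topspace X) \<phi> (coord_perm n) f \<and>
         f ` topspace X \<inter> diagonal n = {})"
proof (intro allI impI, elim conjE)
  fix X :: "'a topology" and \<phi>
  assume X: "compact_space X" "Hausdorff_space X"
    and cont: "continuous_group_action (sym_group n) X \<phi>"
    and free: "free_group_action (sym_group n) (topspace X) \<phi>"
  have n3: "n \<ge> 3"
    using assms(1,2) by (cases "n = 2") auto
  interpret group_action "sym_group n" "topspace X" \<phi>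
    using free by (simp add: free_group_action_def)
  have act: "continuous_map X X (\<phi> p)" if "p permutes {1..n}" for p
  proof -
    have "continuous_map X (prod_topology (discrete_topology (carrier (sym_group n))) X) (\<lambda>x. (p, x))"
      using that by (intro continuous_map_pairedI) (simp_all add: sym_group_carrier)
    then have "continuous_map X X ((\<lambda>(g, x). \<phi> g x) \<circ> (\<lambda>x. (p, x)))"
      using cont by (intro continuous_map_compose) (auto simp: continuous_group_action_def)
    then show ?thesis
      by (simp add: comp_def)
  qed
  have "\<exists>f. continuous_map X euclidean f \<and> f ` topspace X \<subseteq> unit_sphere n \<and>
    (\<forall>p x. p permutes {1..n} \<longrightarrow> x \<in> topspace X \<longrightarrow> f (\<phi> p x) = f x \<circ> inv' p)"
  proof (rule ex_equivariant_map_to_sphere[OF n3 assms(2,3) X act])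
    show "\<phi> id x = x" if "x \<in> topspace X" for x
      using id_eq_one that by (metis restrict_apply' sym_group_one)
    show "\<phi> (p \<circ> q) x = \<phi> p (\<phi> q x)"
      if "p permutes {1..n}" "q permutes {1..n}" "x \<in> topspace X" for p q x
      using composition_rule[of x p q] that by (simp add: sym_group_carrier sym_group_mult)
    show "p = id" if "p permutes {1..n}" "x \<in> topspace X" "\<phi> p x = x" for p x
      using free that by (auto simp: free_group_action_def stabilizer_def sym_group_carrier sym_group_one)
  qed
  then obtain f where f: "continuous_map X euclidean f" "f ` topspace X \<subseteq> unit_sphere n"
    "\<And>p x. p permutes {1..n} \<Longrightarrow> x \<in> topspace X \<Longrightarrow> f (\<phi> p x) = f x \<circ> inv' p"
    by blast
  \<comment> \<open>Restriction turns total functions into the extensional ones that make up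
    \<open>real_space n\<close>.\<close>
  let ?f = "\<lambda>x. restrict (f x) {1..n}"
  have "continuous_map X (product_topology (\<lambda>_. euclideanreal) UNIV) f"
    using f(1) by (simp add: euclidean_product_topology)
  then have "continuous_map X euclideanreal (\<lambda>x. f x i)" for i
    by (rule continuous_map_product_then_coordinatewise) simp
  then have "continuous_map X (real_space n) ?f"
    by (intro continuous_map_coordinatewise_then_product) auto
  moreover have "equivariant_map (sym_group n) (topspace X) \<phi> (coord_perm n) ?f"
    unfolding equivariant_map_def
  proof (intro ballI)
    fix p x
    assume "p \<in> carrier (sym_group n)" and x: "x \<in> topspace X"
    then have p: "p permutes {1..n}"
      by (simp add: sym_group_carrier)
    show "?f (\<phi> p x) = coord_perm n p (?f x)"
      using permutes_in_image[OF permutes_inv[OF p]] f(3)[OF p x]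
      by (auto simp: coord_perm_def fun_eq_iff)
  qed
  moreover have "?f ` topspace X \<inter> diagonal n = {}"
  proof -
    have "?f x \<noteq> (\<lambda>i\<in>{1..n}. u)" if "x \<in> topspace X" for x u
    proof
      assume eq: "?f x = (\<lambda>i\<in>{1..n}. u)"
      have "f x i = u" if "i \<in> {1..n}" for i
        using fun_cong[OF eq, of i] that by simp
      moreover have "f x \<in> nonconst n"
        using f(2) that unit_sphere_subset_nonconst by blast
      ultimately show False
        by (auto simp: nonconst_def)
    qed
    then show ?thesis
      by (auto simp: diagonal_def)
  qed
  ultimately show "\<exists>f. continuous_map X (real_space n) f \<and>
         equivariant_map (sym_group n) (topspace X) \<phi> (coord_perm n) f \<and>
         f ` topspace X \<inter> diagonal n = {}"
    by blast
qed

end
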